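(* Let $k\ge 3$ and $n_1,\dots,n_k\ge 1$ be integers. For a generic tensor $\mathcal A\in\mathbb R^{n_1}\otimes\dots\otimes\mathbb R^{n_k}$, each singular vector tuple of $\mathcal A$ is nondegenerate. That is, there exists a proper Zariski closed subset $X\subset \mathbb R^{n_1}\otimes\dots\otimes\mathbb R^{n_k}$ such that for every $\mathcal A\notin X$ each singular vector tuple of $\mathcal A$ is nondegenerate.
   Context: $\mathbb R^{n_1}\otimes\dots\otimes\mathbb R^{n_k}$ is the space of real tensors $\mathcal A=(a_{i_1\dots i_k})$ of order $k$ and dimension $n_1\times\dots\times n_k$, with inner product $\langle\mathcal A,\mathcal B\rangle=\sum_{i_1=1}^{n_1}\dots\sum_{i_k=1}^{n_k}a_{i_1\dots i_k}b_{i_1\dots i_k}$. For $\mathbf x=(\mathbf x_1,\dots,\mathbf x_k)\in\mathbb R^{n_1}\times\dots\times\mathbb R^{n_k}$, put $\tau(\mathbf x)=\mathbf x_1\otimes\dots\otimes\mathbf x_k$. Let $\mathbb S:=\mathbb S^{n_1-1}\times\dots\times\mathbb S^{n_k-1}$ be the product of the Euclidean unit spheres. A tuple $\mathbf x\in\mathbb S$ is a (real) singular vector tuple of $\mathcal A$ if it is a critical point of the smooth function $G(\mathbf x):=\langle\mathcal A,\tau(\mathbf x)\rangle$ on $\mathbb S$. It is nondegenerate if it is a nondegenerate critical point of $G$ on $\mathbb S$, i.e., the Riemannian Hessian of $G$ at $\mathbf x$ (for the metric on $\mathbb S$ induced from $\mathbb R^{n_1+\dots+n_k}$) is a nonsingular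 linear map from the tangent space of $\mathbb S$ at $\mathbf x$ to itself. A property is generic in a space $\mathbb F^N$ ($\mathbb F=\mathbb R$ or $\mathbb C$) if there is a proper Zariski closed subset $X\subset\mathbb F^N$ such that the property holds outside $X$. *)

theory Defs
  imports Complex_Main "HOL-Library.FuncSet"
begin

text \<open>For a finite index set \<open>I\<close>, the space \<open>\<real>\<^sup>I\<close> is rendered as the real functions vanishing
  outside \<open>I\<close>.  Both the tensor space and the ambient space \<open>\<real>\<close>-to-the-\<open>(n\<^sub>1 + \<dots> + n\<^sub>k)\<close> are of this
  form, so all dimensions may be quantified over.\<close>

definition coord_space :: "'i set \<Rightarrow> ('i \<Rightarrow> real) set" where
  "coord_space I = {x. \<forall>i. i \<notin> I \<longrightarrow> x i = 0}"

definition ip :: "'i set \<Rightarrow> ('i \<Rightarrow> real) \<Rightarrow> ('i \<Rightarrow> real) \<Rightarrow> real" where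
  "ip I x y = (\<Sum>i\<in>I. x i * y i)"


subsection \<open>Zariski closed sets\<close>

inductive polynomial_fun :: "'i set \<Rightarrow> (('i \<Rightarrow> real) \<Rightarrow> real) \<Rightarrow> bool" for I where
  const: "polynomial_fun I (\<lambda>a. c)"
| coord: "i \<in> I \<Longrightarrow> polynomial_fun I (\<lambda>a. a i)"
| add: "polynomial_fun I p \<Longrightarrow> polynomial_fun I q \<Longrightarrow> polynomial_fun I (\<lambda>a. p a + q a)"
| mult: "polynomial_fun I p \<Longrightarrow> polynomial_fun I q \<Longrightarrow> polynomial_fun I (\<lambda>a. p a * q a)"

definition zariski_closed :: "'i set \<Rightarrow> ('i \<Rightarrow> real) set \<Rightarrow> bool" where
  "zariski_closed I X \<longleftrightarrow>
     (\<exists>P. (\<forall>p\<in>P. polynomial_fun I p) \<and> X = {a \<in> coord_space I. \<forall>p\<in>P. p a = 0})"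


subsection \<open>Submanifolds with the induced Riemannian metric\<close>

text \<open>Below, \<open>M\<close> is meant to be a smooth submanifold of \<open>\<real>\<^sup>I\<close> and \<open>f\<close> a smooth function on it.
  Curves are only required to be differentiable at time \<open>0\<close>; for a smooth submanifold these have
  the same velocities as smooth curves, and smooth maps can be differentiated along them.\<close>

definition has_velocity :: "(real \<Rightarrow> 'i \<Rightarrow> real) \<Rightarrow> ('i \<Rightarrow> real) \<Rightarrow> bool" where
  "has_velocity \<gamma> v \<longleftrightarrow> (\<forall>i. ((\<lambda>t. \<gamma> t i) has_real_derivative v i) (at 0))"

definition curve_through ::
    "('i \<Rightarrow> real) set \<Rightarrow> ('i \<Rightarrow> real) \<Rightarrow> ('i \<Rightarrow> real) \<Rightarrow> (real \<Rightarrow> 'i \<Rightarrow> real) \<Rightarrow> bool" where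
  "curve_through M x v \<gamma> \<longleftrightarrow> (\<forall>t. \<gamma> t \<in> M) \<and> \<gamma> 0 = x \<and> has_velocity \<gamma> v"

definition tangent_space :: "('i \<Rightarrow> real) set \<Rightarrow> ('i \<Rightarrow> real) \<Rightarrow> ('i \<Rightarrow> real) set" where
  "tangent_space M x = {v. \<exists>\<gamma>. curve_through M x v \<gamma>}"

definition critical_point :: "('i \<Rightarrow> real) set \<Rightarrow> (('i \<Rightarrow> real) \<Rightarrow> real) \<Rightarrow> ('i \<Rightarrow> real) \<Rightarrow> bool" where
  "critical_point M f x \<longleftrightarrow> x \<in> M \<and>
     (\<forall>v \<gamma>. curve_through M x v \<gamma> \<longrightarrow> ((\<lambda>t. f (\<gamma> t)) has_real_derivative 0) (at 0))"

definition riem_grad ::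
    "'i set \<Rightarrow> ('i \<Rightarrow> real) set \<Rightarrow> (('i \<Rightarrow> real) \<Rightarrow> real) \<Rightarrow> ('i \<Rightarrow> real) \<Rightarrow> ('i \<Rightarrow> real)" where
  "riem_grad I M f x = (THE g. g \<in> tangent_space M x \<and>
     (\<forall>v \<gamma>. curve_through M x v \<gamma> \<longrightarrow> ((\<lambda>t. f (\<gamma> t)) has_real_derivative ip I g v) (at 0)))"

definition orth_proj :: "'i set \<Rightarrow> ('i \<Rightarrow> real) set \<Rightarrow> ('i \<Rightarrow> real) \<Rightarrow> ('i \<Rightarrow> real)" where
  "orth_proj I T w = (THE p. p \<in> T \<and> (\<forall>u\<in>T. ip I (\<lambda>i. w i - p i) u = 0))"

text \<open>The Hessian sends \<open>v\<close> to the covariant derivative of the gradient field in direction \<open>v\<close>.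
  For the induced metric, the Levi-Civita derivative of a tangent field along a curve is the
  orthogonal projection onto the tangent space of its derivative in \<open>\<real>\<^sup>I\<close>; the result depends
  only on the velocity \<open>v\<close> of the curve.\<close>

definition riem_hessian ::
    "'i set \<Rightarrow> ('i \<Rightarrow> real) set \<Rightarrow> (('i \<Rightarrow> real) \<Rightarrow> real) \<Rightarrow> ('i \<Rightarrow> real) \<Rightarrow>
     ('i \<Rightarrow> real) \<Rightarrow> ('i \<Rightarrow> real)" where
  "riem_hessian I M f x v = (THE w. \<forall>\<gamma>. curve_through M x v \<gamma> \<longrightarrow>
     (\<exists>u. has_velocity (\<lambda>t. riem_grad I M f (\<gamma> t)) u \<and> w = orth_proj I (tangent_space M x) u))"

text \<open>Since the Hessian is linear on the tangent space, nonsingularity is bijectivity.\<close>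

definition nondegenerate_critical_point ::
    "'i set \<Rightarrow> ('i \<Rightarrow> real) set \<Rightarrow> (('i \<Rightarrow> real) \<Rightarrow> real) \<Rightarrow> ('i \<Rightarrow> real) \<Rightarrow> bool" where
  "nondegenerate_critical_point I M f x \<longleftrightarrow> critical_point M f x \<and>
     bij_betw (riem_hessian I M f x) (tangent_space M x) (tangent_space M x)"


subsection \<open>Tensors and singular vector tuples\<close>

definition tensor_indices :: "nat \<Rightarrow> (nat \<Rightarrow> nat) \<Rightarrow> (nat \<Rightarrow> nat) set" where
  "tensor_indices k n = (\<Pi>\<^sub>E j\<in>{1..k}. {1..n j})"

definition tensors :: "nat \<Rightarrow> (nat \<Rightarrow> nat) \<Rightarrow> ((nat \<Rightarrow> nat) \<Rightarrow> real) set" where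
  "tensors k n = coord_space (tensor_indices k n)"

text \<open>A tuple \<open>(x\<^sub>1, \<dots>, x\<^sub>k)\<close> is a function \<open>x\<close> on pairs: \<open>x (j, i)\<close> is the \<open>i\<close>-th coordinate
  of \<open>x\<^sub>j\<close>.\<close>

definition tuple_indices :: "nat \<Rightarrow> (nat \<Rightarrow> nat) \<Rightarrow> (nat \<times> nat) set" where
  "tuple_indices k n = (SIGMA j:{1..k}. {1..n j})"

definition rank_one :: "nat \<Rightarrow> (nat \<Rightarrow> nat) \<Rightarrow> (nat \<times> nat \<Rightarrow> real) \<Rightarrow> (nat \<Rightarrow> nat) \<Rightarrow> real" where
  "rank_one k n x = (\<lambda>\<iota>. if \<iota> \<in> tensor_indices k n then \<Prod>j\<in>{1..k}. x (j, \<iota> j) else 0)"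

definition sphere_product :: "nat \<Rightarrow> (nat \<Rightarrow> nat) \<Rightarrow> (nat \<times> nat \<Rightarrow> real) set" where
  "sphere_product k n = {x \<in> coord_space (tuple_indices k n).
     \<forall>j\<in>{1..k}. (\<Sum>i\<in>{1..n j}. (x (j, i))\<^sup>2) = 1}"

definition tensor_form ::
    "nat \<Rightarrow> (nat \<Rightarrow> nat) \<Rightarrow> ((nat \<Rightarrow> nat) \<Rightarrow> real) \<Rightarrow> (nat \<times> nat \<Rightarrow> real) \<Rightarrow> real" where
  "tensor_form k n A x = ip (tensor_indices k n) A (rank_one k n x)"

definition singular_vector_tuple ::
    "nat \<Rightarrow> (nat \<Rightarrow> nat) \<Rightarrow> ((nat \<Rightarrow> nat) \<Rightarrow> real) \<Rightarrow> (nat \<times> nat \<Rightarrow> real) \<Rightarrow> bool" where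
  "singular_vector_tuple k n A x \<longleftrightarrow> critical_point (sphere_product k n) (tensor_form k n A) x"

definition nondegenerate_tuple ::
    "nat \<Rightarrow> (nat \<Rightarrow> nat) \<Rightarrow> ((nat \<Rightarrow> nat) \<Rightarrow> real) \<Rightarrow> (nat \<times> nat \<Rightarrow> real) \<Rightarrow> bool" where
  "nondegenerate_tuple k n A x \<longleftrightarrow>
     nondegenerate_critical_point (tuple_indices k n) (sphere_product k n) (tensor_form k n A) x"

end

theory Submission
  imports Defs "Jordan_Normal_Form.Determinant"
begin

text \<open>
  The tensors that have a degenerate singular tuple lie in the image of a hypersurface in the tensor
  space \<open>\<real>\<^sup>I\<close> under a polynomial map of \<open>\<real>\<^sup>I\<close> into itself. For reasons of dimension such an image
  cannot be Zariski dense, and one polynomial that vanishes on it defines the exceptional set.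

  To find the map, let \<open>x\<close> be a singular tuple of \<open>A\<close> and take orthonormal bases of the factors that
  start with the vectors \<open>x\<^sub>j\<close> (locale \<open>adapted_frame\<close>). In such a frame the coordinates of \<open>A\<close> with
  exactly one index different from \<open>1\<close> are the first derivatives of the form at \<open>x\<close>, and they vanish.
  The coordinate \<open>\<mu>\<close> with all indices \<open>1\<close> is the value of the form. The Hessian at \<open>x\<close> is the
  symmetric matrix \<open>B - \<mu>\<close>, where the entries of \<open>B\<close> in blocks for different factors are the
  coordinates with two indices different from \<open>1\<close>, and the blocks of \<open>B\<close> for a single factor are zero
  (\<open>nondegenerate_if_hessian_invertible\<close>). Householder reflections provide such frames that depend
  rationally on \<open>(n\<^sub>1 - 1) + \<dots> + (n\<^sub>k - 1)\<close> parameters. This is also the number of coordinates that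
  vanish, so the parameters can be stored in their places. Since degeneracy does not change when \<open>A\<close> is
  multiplied by a nonzero number, the denominators can be dropped, and every tensor with a singular
  tuple becomes a value of one polynomial map \<open>reflected_tensor\<close> (\<open>singular_tuple_normal_form\<close>).

  If the tuple is degenerate, then \<open>\<mu>\<close> is a root of the characteristic polynomial of \<open>B\<close>. This is a
  monic equation for the coordinate \<open>\<mu>\<close> whose coefficients are polynomials in the other coordinates
  (\<open>characteristic_relation\<close>). The monomials with exponents below \<open>K\<close>, pulled back to such a hypersurface,
  span a space of dimension \<open>O(K\<^bsup>N-1\<^esup>)\<close> with \<open>N = card I\<close>, while their number is \<open>K\<^sup>N\<close>;
  hence a nonzero polynomial vanishes on the image
  (\<open>image_of_monic_hypersurface_not_dense\<close>). This counting argument takes the place of the theorems of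
  Sard and of Tarski and Seidenberg.
\<close>

section \<open>Polynomial functions\<close>

lemma polynomial_fun_prod:
  assumes "finite S" "\<And>s. s \<in> S \<Longrightarrow> polynomial_fun I (f s)"
  shows "polynomial_fun I (\<lambda>a. \<Prod>s\<in>S. f s a)"
  using assms by (induction S) (auto intro: polynomial_fun.intros)

lemma polynomial_fun_sum:
  assumes "finite S" "\<And>s. s \<in> S \<Longrightarrow> polynomial_fun I (f s)"
  shows "polynomial_fun I (\<lambda>a. \<Sum>s\<in>S. f s a)"
  using assms by (induction S) (auto intro: polynomial_fun.intros)

lemma polynomial_fun_power: "polynomial_fun I f \<Longrightarrow> polynomial_fun I (\<lambda>a. f a ^ e)"
  by (induction e) (auto intro: polynomial_fun.intros)

lemma polynomial_fun_local:
  assumes "polynomial_fun I p" "\<And>i. i \<in> I \<Longrightarrow> a i = b i"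
  shows "p a = p b"
  using assms by (induction rule: polynomial_fun.induct) auto

lemma polynomial_fun_subst:
  assumes "polynomial_fun K p" "\<And>k. k \<in> K \<Longrightarrow> polynomial_fun I (f k)"
  shows "polynomial_fun I (\<lambda>a. p (\<lambda>k. f k a))"
  using assms by (induction rule: polynomial_fun.induct) (auto intro: polynomial_fun.intros)

text \<open>The index \<open>d\<close> is only an upper bound for the degree. Building up products one coordinate
  at a time, and not from two arbitrary factors, makes it possible to reduce a polynomial modulo an
  equation by induction: only multiplication by a single coordinate has to be treated.\<close>

inductive poly_of_degree :: "'i set \<Rightarrow> nat \<Rightarrow> (('i \<Rightarrow> real) \<Rightarrow> real) \<Rightarrow> bool" for I where
  const: "poly_of_degree I d (\<lambda>a. c)"
| coord_mult: "i \<in> I \<Longrightarrow> poly_of_degree I d f \<Longrightarrow> poly_of_degree I (Suc d) (\<lambda>a. a i * f a)"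
| add: "poly_of_degree I d f \<Longrightarrow> poly_of_degree I d g \<Longrightarrow> poly_of_degree I d (\<lambda>a. f a + g a)"

lemma poly_of_degree_mono: "poly_of_degree I d f \<Longrightarrow> d \<le> e \<Longrightarrow> poly_of_degree I e f"
proof (induction arbitrary: e rule: poly_of_degree.induct)
  case (coord_mult i d f)
  then obtain e' where "e = Suc e'" "d \<le> e'" by (cases e) auto
  then show ?case using coord_mult by (auto intro: poly_of_degree.coord_mult)
qed (auto intro: poly_of_degree.intros)

lemma poly_of_degree_mult:
  assumes "poly_of_degree I d f" "poly_of_degree I e g"
  shows "poly_of_degree I (d + e) (\<lambda>a. f a * g a)"
  using assms(1)
proof (induction rule: poly_of_degree.induct)
  case (const d c)
  from assms(2) have "poly_of_degree I e (\<lambda>a. c * g a)"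
  proof (induction rule: poly_of_degree.induct)
    case (coord_mult i d f)
    then show ?case
      using poly_of_degree.coord_mult[of i I d "\<lambda>a. c * f a"] by (simp add: mult.left_commute)
  next
    case (add d f g)
    then show ?case
      using poly_of_degree.add[of I d "\<lambda>a. c * f a" "\<lambda>a. c * g a"] by (simp add: distrib_left)
  qed (auto intro: poly_of_degree.intros)
  then show ?case by (rule poly_of_degree_mono) simp
next
  case (coord_mult i d f)
  then show ?case
    using poly_of_degree.coord_mult[of i I "d + e" "\<lambda>a. f a * g a"] by (simp add: mult.assoc)
next
  case (add d f h)
  then show ?case
    using poly_of_degree.add[of I "d + e" "\<lambda>a. f a * g a" "\<lambda>a. h a * g a"]
    by (simp add: distrib_right)
qed

lemma poly_of_degree_power:
  "poly_of_degree I d f \<Longrightarrow> poly_of_degree I (e * d) (\<lambda>a. f a ^ e)"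
  by (induction e) (auto intro: poly_of_degree.const poly_of_degree_mult)

lemma poly_of_degree_prod:
  assumes "finite S" "\<And>s. s \<in> S \<Longrightarrow> poly_of_degree I d (f s)"
  shows "poly_of_degree I (card S * d) (\<lambda>a. \<Prod>s\<in>S. f s a)"
  using assms by (induction S) (auto intro: poly_of_degree.const poly_of_degree_mult)

lemma polynomial_fun_has_degree:
  assumes "polynomial_fun I f"
  shows "\<exists>d. poly_of_degree I d f"
  using assms
proof (induction rule: polynomial_fun.induct)
  case (coord i)
  then show ?case using poly_of_degree.coord_mult[OF coord poly_of_degree.const[of I 0 1]] by auto
next
  case (add p q)
  then obtain d e where "poly_of_degree I d p" "poly_of_degree I e q" by auto
  then have "poly_of_degree I (max d e) p" "poly_of_degree I (max d e) q"
    by (auto elim!: poly_of_degree_mono)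
  then show ?case by (auto intro: poly_of_degree.add)
qed (auto intro: poly_of_degree.const poly_of_degree_mult)

lemma polynomial_funs_have_degree:
  assumes "finite S" "\<And>s. s \<in> S \<Longrightarrow> polynomial_fun I (f s)"
  shows "\<exists>d. \<forall>s\<in>S. poly_of_degree I d (f s)"
proof -
  have "\<forall>s\<in>S. \<exists>d. poly_of_degree I d (f s)"
    using assms(2) polynomial_fun_has_degree by blast
  then obtain d where d: "\<forall>s\<in>S. poly_of_degree I (d s) (f s)" by metis
  have "d s \<le> (\<Sum>s\<in>S. d s)" if "s \<in> S" for s
    using assms(1) that by (intro member_le_sum) auto
  then show ?thesis using d poly_of_degree_mono by blast
qed

section \<open>Reduction modulo a monic equation\<close>

text \<open>Let \<open>Z\<close> be a set on which coordinate \<open>b\<close> satisfies a monic equation of degree \<open>m\<close> whose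
  coefficients are polynomials in the coordinates \<open>J\<close>. On \<open>Z\<close> every power of \<open>a b\<close> can be
  lowered below \<open>m\<close>, so that every polynomial agrees there with a combination of the monomials below.
  The exponents of the coordinates in \<open>J\<close> are bounded separately, by \<open>d\<close>; the monomials are then
  counted by a power of \<open>d + 1\<close> with exponent \<open>card J\<close>, one less than the number of all coordinates.\<close>

definition reduced_monomial ::
  "'i set \<Rightarrow> 'i \<Rightarrow> ('i \<Rightarrow> nat) \<times> nat \<Rightarrow> ('i \<Rightarrow> real) \<Rightarrow> real" where
  "reduced_monomial J b t a = (\<Prod>j\<in>J. a j ^ fst t j) * a b ^ snd t"

abbreviation reduced_exponents :: "'i set \<Rightarrow> nat \<Rightarrow> nat \<Rightarrow> (('i \<Rightarrow> nat) \<times> nat) set" where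
  "reduced_exponents J m d \<equiv> (\<Pi>\<^sub>E j\<in>J. {..d}) \<times> {..<m}"

definition reducible ::
  "('i \<Rightarrow> real) set \<Rightarrow> 'i set \<Rightarrow> 'i \<Rightarrow> nat \<Rightarrow> nat \<Rightarrow> (('i \<Rightarrow> real) \<Rightarrow> real) \<Rightarrow> bool" where
  "reducible Z J b m d f \<longleftrightarrow>
     (\<exists>w. \<forall>a\<in>Z. f a = (\<Sum>t\<in>reduced_exponents J m d. w t * reduced_monomial J b t a))"

lemma reducible_add:
  assumes "reducible Z J b m d f" "reducible Z J b m d g"
  shows "reducible Z J b m d (\<lambda>a. f a + g a)"
proof -
  obtain v w where
    "\<forall>a\<in>Z. f a = (\<Sum>t\<in>reduced_exponents J m d. v t * reduced_monomial J b t a)"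
    "\<forall>a\<in>Z. g a = (\<Sum>t\<in>reduced_exponents J m d. w t * reduced_monomial J b t a)"
    using assms unfolding reducible_def by auto
  then show ?thesis unfolding reducible_def
    by (intro exI[of _ "\<lambda>t. v t + w t"]) (simp add: distrib_right sum.distrib)
qed

lemma reducible_scale:
  assumes "reducible Z J b m d f"
  shows "reducible Z J b m d (\<lambda>a. c * f a)"
proof -
  obtain v where
    "\<forall>a\<in>Z. f a = (\<Sum>t\<in>reduced_exponents J m d. v t * reduced_monomial J b t a)"
    using assms unfolding reducible_def by auto
  then show ?thesis unfolding reducible_def
    by (intro exI[of _ "\<lambda>t. c * v t"]) (simp add: sum_distrib_left mult.assoc)
qed

lemma reducible_zero: "reducible Z J b m d (\<lambda>a. 0)"
  unfolding reducible_def by (intro exI[of _ "\<lambda>t. 0"]) simp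

lemma reducible_sum:
  assumes "finite S" "\<And>s. s \<in> S \<Longrightarrow> reducible Z J b m d (f s)"
  shows "reducible Z J b m d (\<lambda>a. \<Sum>s\<in>S. f s a)"
  using assms by (induction S) (auto intro: reducible_zero reducible_add)

lemma reducible_cong:
  "(\<And>a. a \<in> Z \<Longrightarrow> f a = g a) \<Longrightarrow> reducible Z J b m d f \<longleftrightarrow> reducible Z J b m d g"
  unfolding reducible_def by auto

lemma reducible_monomial:
  assumes "finite J" "t \<in> reduced_exponents J m d"
  shows "reducible Z J b m d (reduced_monomial J b t)"
  unfolding reducible_def
proof (intro exI ballI)
  fix a
  have "finite (reduced_exponents J m d)" using assms(1) by (auto intro!: finite_PiE)
  then show "reduced_monomial J b t a =
    (\<Sum>s\<in>reduced_exponents J m d. (if s = t then 1 else 0) * reduced_monomial J b s a)"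
    using assms(2) by (simp add: sum.delta if_distrib[of "\<lambda>x. x * _"] cong: if_cong)
qed

lemma reducible_mult_by_monomials:
  assumes "finite J" "reducible Z J b m d f"
    and mono: "\<And>t. t \<in> reduced_exponents J m d \<Longrightarrow>
      reducible Z J b m e (\<lambda>a. h a * reduced_monomial J b t a)"
  shows "reducible Z J b m e (\<lambda>a. h a * f a)"
proof -
  obtain w where w:
    "\<forall>a\<in>Z. f a = (\<Sum>t\<in>reduced_exponents J m d. w t * reduced_monomial J b t a)"
    using assms(2) unfolding reducible_def by auto
  have fin: "finite (reduced_exponents J m d)" using assms(1) by (auto intro!: finite_PiE)
  have "reducible Z J b m e
      (\<lambda>a. \<Sum>t\<in>reduced_exponents J m d. w t * (h a * reduced_monomial J b t a))"
    by (intro reducible_sum[OF fin] reducible_scale mono)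
  then show ?thesis
    by (subst reducible_cong) (auto simp: w sum_distrib_left mult_ac)
qed

lemma reducible_mono:
  assumes "finite J" "reducible Z J b m d f" "d \<le> e"
  shows "reducible Z J b m e f"
proof -
  have "reducible Z J b m e (\<lambda>a. 1 * f a)"
  proof (rule reducible_mult_by_monomials[OF assms(1,2)])
    fix t assume "t \<in> reduced_exponents J m d"
    then have "t \<in> reduced_exponents J m e" using assms(3) by (fastforce simp: PiE_iff)
    then show "reducible Z J b m e (\<lambda>a. 1 * reduced_monomial J b t a)"
      using reducible_monomial[OF assms(1)] by simp
  qed
  then show ?thesis by simp
qed

lemma reducible_mult_coord:
  assumes "finite J" "reducible Z J b m d f" "j \<in> J"
  shows "reducible Z J b m (Suc d) (\<lambda>a. a j * f a)"
proof (rule reducible_mult_by_monomials[OF assms(1,2)])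
  fix t assume t: "t \<in> reduced_exponents J m d"
  obtain \<alpha> i where ti: "t = (\<alpha>, i)" by (cases t)
  define s where "s = (\<alpha>(j := Suc (\<alpha> j)), i)"
  have s: "s \<in> reduced_exponents J m (Suc d)"
    using t assms(3) by (auto simp: s_def ti PiE_iff extensional_def)
  have "a j * reduced_monomial J b t a = reduced_monomial J b s a" for a
  proof -
    have "(\<Prod>l\<in>J. a l ^ fst s l) = a j * (\<Prod>l\<in>J. a l ^ \<alpha> l)"
      using assms(1,3) by (subst (1 2) prod.remove[of _ j]) (auto simp: s_def intro!: prod.cong)
    then show ?thesis by (simp add: reduced_monomial_def ti s_def mult_ac)
  qed
  then show "reducible Z J b m (Suc d) (\<lambda>a. a j * reduced_monomial J b t a)"
    using reducible_monomial[OF assms(1) s] by (simp add: fun_eq_iff)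
qed

lemma reducible_mult_poly:
  assumes "finite J" "reducible Z J b m d f" "poly_of_degree J e g"
  shows "reducible Z J b m (d + e) (\<lambda>a. g a * f a)"
  using assms(3)
proof (induction rule: poly_of_degree.induct)
  case (const e c)
  show ?case by (intro reducible_scale reducible_mono[OF assms(1,2)]) simp
next
  case (coord_mult j e g)
  have "reducible Z J b m (Suc (d + e)) (\<lambda>a. a j * (g a * f a))"
    by (rule reducible_mult_coord[OF assms(1) coord_mult.IH coord_mult.hyps(1)])
  then show ?case by (simp add: mult_ac)
next
  case (add e g h)
  then show ?case by (simp add: distrib_right reducible_add)
qed

text \<open>Multiplying a reduced monomial by \<open>a b\<close> leaves the reduced range only at the exponent \<open>m - 1\<close>;
  there the monic equation applies, and its coefficients raise the other exponents by at most \<open>E\<close>.\<close>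

lemma reducible_mult_root:
  assumes "finite J" "reducible Z J b m d f"
    and c: "\<And>i. i < m \<Longrightarrow> poly_of_degree J E (c i)"
    and Z: "\<And>a. a \<in> Z \<Longrightarrow> a b ^ m = (\<Sum>i<m. c i a * a b ^ i)"
  shows "reducible Z J b m (d + E) (\<lambda>a. a b * f a)"
proof (rule reducible_mult_by_monomials[OF assms(1,2)])
  fix t assume t: "t \<in> reduced_exponents J m d"
  obtain \<alpha> i where ti: "t = (\<alpha>, i)" by (cases t)
  have *: "reducible Z J b m d (reduced_monomial J b (\<alpha>, l))" if "l < m" for l
    using t that by (intro reducible_monomial[OF assms(1)]) (auto simp: ti)
  show "reducible Z J b m (d + E) (\<lambda>a. a b * reduced_monomial J b t a)"
  proof (cases "Suc i < m")
    case True
    then show ?thesis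
      using reducible_mono[OF assms(1) *[OF True], of "d + E"]
      by (simp add: reduced_monomial_def[abs_def] ti mult_ac)
  next
    case False
    with t have i: "m = Suc i" by (auto simp: ti)
    have "reducible Z J b m (d + E) (\<lambda>a. \<Sum>l<m. c l a * reduced_monomial J b (\<alpha>, l) a)"
      by (intro reducible_sum reducible_mult_poly[OF assms(1) *] c) auto
    moreover have "a b * reduced_monomial J b t a =
        (\<Sum>l<m. c l a * reduced_monomial J b (\<alpha>, l) a)" if "a \<in> Z" for a
    proof -
      have "a b * reduced_monomial J b t a = (\<Prod>j\<in>J. a j ^ \<alpha> j) * a b ^ m"
        by (simp add: reduced_monomial_def ti i)
      also have "\<dots> = (\<Prod>j\<in>J. a j ^ \<alpha> j) * (\<Sum>l<m. c l a * a b ^ l)"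
        using Z[OF that] by (rule arg_cong)
      finally show ?thesis by (simp add: reduced_monomial_def sum_distrib_left mult_ac)
    qed
    ultimately show ?thesis by (subst reducible_cong) auto
  qed
qed

text \<open>Each of the at most \<open>d\<close> factors of a monomial, whether it is \<open>a b\<close> or another coordinate,
  costs at most \<open>E + 1\<close> in the exponents, so the exponents grow linearly in \<open>d\<close>. The dimension
  count rests on this linear bound.\<close>

lemma poly_reducible:
  assumes "finite I" "b \<in> I" "poly_of_degree I d f"
    and c: "\<And>i. i < m \<Longrightarrow> poly_of_degree (I - {b}) E (c i)"
    and Z: "\<And>a. a \<in> Z \<Longrightarrow> a b ^ m = (\<Sum>i<m. c i a * a b ^ i)"
  shows "reducible Z (I - {b}) b m (d * Suc E) f"
  using assms(3)
proof (induction rule: poly_of_degree.induct)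
  case (const d e)
  have fin: "finite (I - {b})" using assms(1) by simp
  show ?case
  proof (cases "m = 0")
    case True
    \<comment> \<open>For \<open>m = 0\<close> the monic equation reads \<open>1 = 0\<close>.\<close>
    then have "Z = {}" using Z by auto
    then show ?thesis by (simp add: reducible_def)
  next
    case False
    define t where "t = (\<lambda>j\<in>I - {b}. 0 :: nat, 0 :: nat)"
    have "t \<in> reduced_exponents (I - {b}) m (d * Suc E)"
      using False by (auto simp: t_def)
    from reducible_scale[OF reducible_monomial[OF fin this], of Z b e]
    show ?thesis by (simp add: reduced_monomial_def t_def)
  qed
next
  case (coord_mult i d f)
  have fin: "finite (I - {b})" using assms(1) by simp
  show ?case
  proof (cases "i = b")
    case True
    have "reducible Z (I - {b}) b m (d * Suc E + E) (\<lambda>a. a b * f a)"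
      by (rule reducible_mult_root[OF fin coord_mult.IH c Z]) auto
    then show ?thesis by (simp add: True) (rule reducible_mono[OF fin], auto)
  next
    case False
    have "reducible Z (I - {b}) b m (Suc (d * Suc E)) (\<lambda>a. a i * f a)"
      by (rule reducible_mult_coord[OF fin coord_mult.IH]) (use False coord_mult.hyps in auto)
    then show ?thesis by (rule reducible_mono[OF fin]) auto
  qed
next
  case (add d f g)
  show ?case by (rule reducible_add[OF add.IH])
qed

section \<open>Polynomial images of hypersurfaces\<close>

text \<open>Gaussian elimination: the unknown of a pivot \<open>s0\<close> is eliminated from all equations together
  with the equation \<open>t\<close>.\<close>

lemma underdetermined_system:
  fixes c :: "'s \<Rightarrow> 't \<Rightarrow> real"
  assumes "finite T" "finite S" "card T < card S"
  shows "\<exists>w. (\<exists>s\<in>S. w s \<noteq> 0) \<and> (\<forall>t\<in>T. (\<Sum>s\<in>S. w s * c s t) = 0)"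
  using assms
proof (induction T arbitrary: S c rule: finite_induct)
  case empty
  then have "S \<noteq> {}" by auto
  then show ?case by (intro exI[of _ "\<lambda>_. 1"]) auto
next
  case (insert t T)
  show ?case
  proof (cases "\<forall>s\<in>S. c s t = 0")
    case True
    have "card T < card S" using insert by auto
    from insert.IH[OF insert.prems(1) this, of c] True show ?thesis by auto
  next
    case False
    then obtain s0 where s0: "s0 \<in> S" "c s0 t \<noteq> 0" by auto
    define S' where "S' = S - {s0}"
    have S: "S = insert s0 S'" "s0 \<notin> S'" "finite S'" using s0 insert.prems by (auto simp: S'_def)
    have "card T < card S'" using insert S by auto
    define c' where "c' = (\<lambda>s u. c s u - c s t / c s0 t * c s0 u)"
    obtain w where w: "\<exists>s\<in>S'. w s \<noteq> 0" "\<forall>u\<in>T. (\<Sum>s\<in>S'. w s * c' s u) = 0"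
      using insert.IH[OF S(3) \<open>card T < card S'\<close>, of c'] by auto
    define v where "v = w(s0 := - (\<Sum>s\<in>S'. w s * (c s t / c s0 t)))"
    have *: "(\<Sum>s\<in>S. v s * c s u) = (\<Sum>s\<in>S'. w s * c' s u)" for u
    proof -
      have "(\<Sum>s\<in>S'. v s * c s u) = (\<Sum>s\<in>S'. w s * c s u)"
        using S by (intro sum.cong) (auto simp: v_def)
      then show ?thesis
        using S by (simp add: v_def c'_def algebra_simps sum_subtractf sum_distrib_left sum_distrib_right)
    qed
    have "c' s t = 0" for s using s0 by (simp add: c'_def)
    then have "\<forall>u\<in>insert t T. (\<Sum>s\<in>S. v s * c s u) = 0" using w(2) by (simp add: *)
    moreover have "\<exists>s\<in>S. v s \<noteq> 0" using w(1) S by (auto simp: v_def)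
    ultimately show ?thesis by blast
  qed
qed

text \<open>The digits of \<open>e\<close> in base \<open>K\<close> label the monomials in \<open>N\<close> variables with exponents
  below \<open>K\<close> by the numbers below \<open>K ^ N\<close>. Under the Kronecker substitution, which puts
  \<open>x ^ (K ^ r)\<close> for the variable number \<open>r\<close>, the monomial labelled \<open>e\<close> becomes \<open>x ^ e\<close>.\<close>

lemma digit_expansion:
  fixes e K :: nat
  shows "(\<Sum>r<N. K ^ r * ((e div K ^ r) mod K)) = e mod K ^ N"
proof (induction N)
  case (Suc N)
  have "e mod K ^ Suc N = K ^ N * (e div K ^ N mod K) + e mod K ^ N"
    unfolding power_Suc2 by (rule mod_mult2_eq)
  then show ?case using Suc by simp
qed simp

text \<open>The hypersurface \<open>Z\<close> has one dimension less than the space, so its image under the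
  polynomial map \<open>F\<close> cannot be Zariski dense. Counting makes this precise: with \<open>N = card I\<close> there
  are \<open>K ^ N\<close> monomials with exponents below \<open>K\<close>, but their pullbacks along \<open>F\<close>, restricted
  to \<open>Z\<close>, lie in a space whose dimension grows only like \<open>K ^ (N - 1)\<close>. For large \<open>K\<close> some
  nontrivial combination of the monomials therefore vanishes on the image, and by the Kronecker
  substitution it is not the zero function.\<close>

lemma image_of_monic_hypersurface_not_dense:
  fixes F :: "'i \<Rightarrow> ('i \<Rightarrow> real) \<Rightarrow> real"
  assumes "finite I" "b \<in> I"
    and F: "\<And>i. i \<in> I \<Longrightarrow> polynomial_fun I (F i)"
    and c: "\<And>l. l < m \<Longrightarrow> polynomial_fun (I - {b}) (c l)"
  shows "\<exists>p. polynomial_fun I p \<and> (\<exists>a. p a \<noteq> 0) \<and>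
    (\<forall>a. a b ^ m = (\<Sum>l<m. c l a * a b ^ l) \<longrightarrow> p (\<lambda>i. F i a) = 0)"
proof -
  define N where "N = card I"
  have N: "N > 0" "card (I - {b}) = N - 1" using assms(1,2) by (auto simp: N_def card_gt_0_iff)
  obtain D where D: "\<forall>i\<in>I. poly_of_degree I D (F i)"
    using polynomial_funs_have_degree[of I I F] assms by auto
  obtain E where E: "\<forall>l\<in>{..<m}. poly_of_degree (I - {b}) E (c l)"
    using polynomial_funs_have_degree[of "{..<m}" "I - {b}" c] c by auto
  define C where "C = N * D * Suc E"
  \<comment> \<open>The exponents of the reduced monomials are at most \<open>C * K\<close>. There are
    \<open>m * (C * K + 1) ^ (N - 1)\<close> of them, at most \<open>m * (C + 1) ^ (N - 1) * K ^ (N - 1)\<close>, and this is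
    below \<open>K ^ N\<close> for the chosen \<open>K\<close>.\<close>
  define K where "K = m * Suc C ^ (N - 1) + 1"
  define Z where "Z = {a. a b ^ m = (\<Sum>l<m. c l a * a b ^ l)}"
  define T where "T = reduced_exponents (I - {b}) m (C * K)"
  have K: "K > 0" by (simp add: K_def)
  have finT: "finite T" using assms(1) by (auto simp: T_def intro!: finite_PiE)
  have "card T = m * Suc (C * K) ^ (N - 1)"
    using assms(1) N by (simp add: T_def card_PiE card_cartesian_product)
  also have "\<dots> \<le> m * (Suc C * K) ^ (N - 1)"
    using K by (intro mult_left_mono power_mono) auto
  also have "\<dots> = (m * Suc C ^ (N - 1)) * K ^ (N - 1)"
    by (simp add: power_mult_distrib del: mult_Suc)
  also have "\<dots> < K * K ^ (N - 1)"
    using K by (intro mult_strict_right_mono) (simp add: K_def, simp)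
  also have "\<dots> = K ^ N" using N by (metis power_eq_if not_gr_zero)
  finally have card: "card T < card {..<K ^ N}" by simp
  obtain r where r: "bij_betw r I {..<N}"
    using ex_bij_betw_finite_nat[OF assms(1)] by (auto simp: N_def atLeast0LessThan)
  define M where "M = (\<lambda>e (a :: 'i \<Rightarrow> real). \<Prod>i\<in>I. a i ^ ((e div K ^ r i) mod K))"
  have "poly_of_degree I (N * (K * D)) (\<lambda>a. M e (\<lambda>i. F i a))" for e
    unfolding M_def N_def
  proof (intro poly_of_degree_prod[OF assms(1)])
    fix i assume "i \<in> I"
    then have "poly_of_degree I ((e div K ^ r i) mod K * D) (\<lambda>a. F i a ^ ((e div K ^ r i) mod K))"
      using D by (intro poly_of_degree_power) auto
    then show "poly_of_degree I (K * D) (\<lambda>a. F i a ^ ((e div K ^ r i) mod K))"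
      by (rule poly_of_degree_mono) (use K in \<open>intro mult_right_mono, auto\<close>)
  qed
  then have "reducible Z (I - {b}) b m (N * (K * D) * Suc E) (\<lambda>a. M e (\<lambda>i. F i a))" for e
    by (rule poly_reducible[OF assms(1,2)]) (use E in \<open>auto simp: Z_def\<close>)
  then have "\<forall>e. \<exists>w. \<forall>a\<in>Z. M e (\<lambda>i. F i a) = (\<Sum>t\<in>T. w t * reduced_monomial (I - {b}) b t a)"
    unfolding reducible_def T_def C_def by (simp add: mult_ac)
  then obtain q where
    q: "\<And>e a. a \<in> Z \<Longrightarrow> M e (\<lambda>i. F i a) = (\<Sum>t\<in>T. q e t * reduced_monomial (I - {b}) b t a)"
    by metis
  obtain w where w: "\<exists>e\<in>{..<K ^ N}. w e \<noteq> 0" "\<forall>t\<in>T. (\<Sum>e<K ^ N. w e * q e t) = 0"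
    using underdetermined_system[OF finT finite_lessThan card] by blast
  define p where "p = (\<lambda>a. \<Sum>e<K ^ N. w e * M e a)"
  have "polynomial_fun I p"
    unfolding p_def M_def
    by (intro polynomial_fun_sum polynomial_fun.mult polynomial_fun.const polynomial_fun_prod
        polynomial_fun_power polynomial_fun.coord) (use assms(1) in auto)
  moreover have "p (\<lambda>i. F i a) = 0" if "a \<in> Z" for a
  proof -
    have "p (\<lambda>i. F i a) = (\<Sum>e<K ^ N. \<Sum>t\<in>T. (w e * q e t) * reduced_monomial (I - {b}) b t a)"
      by (simp add: p_def q[OF that] sum_distrib_left mult.assoc)
    also have "\<dots> = (\<Sum>t\<in>T. (\<Sum>e<K ^ N. w e * q e t) * reduced_monomial (I - {b}) b t a)"
      by (subst sum.swap) (simp add: sum_distrib_right)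
    finally show ?thesis using w(2) by simp
  qed
  moreover have "\<exists>a. p a \<noteq> 0"
  proof (rule ccontr)
    assume "\<not> (\<exists>a. p a \<noteq> 0)"
    then have zero: "p a = 0" for a by auto
    have "M e (\<lambda>i. x ^ (K ^ r i)) = x ^ e" if "e < K ^ N" for e and x :: real
    proof -
      have "M e (\<lambda>i. x ^ (K ^ r i)) = x ^ (\<Sum>i\<in>I. K ^ r i * ((e div K ^ r i) mod K))"
        by (simp add: M_def power_sum power_mult)
      also have "(\<Sum>i\<in>I. K ^ r i * ((e div K ^ r i) mod K)) = (\<Sum>s<N. K ^ s * ((e div K ^ s) mod K))"
        by (rule sum.reindex_bij_betw[OF r])
      also have "\<dots> = e" using that by (simp add: digit_expansion)
      finally show ?thesis .
    qed
    then have "(\<Sum>e<K ^ N. w e * x ^ e) = 0" for x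
      using zero[of "\<lambda>i. x ^ (K ^ r i)"] by (simp add: p_def)
    moreover obtain L where L: "K ^ N = Suc L"
      using zero_less_power[OF K, of N] gr0_conv_Suc by blast
    ultimately have "\<forall>e\<le>L. w e = 0" using polyfun_eq_0[of w L] by (simp add: lessThan_Suc_atMost)
    then show False using w(1) by (auto simp: L)
  qed
  ultimately show ?thesis by (auto simp: Z_def)
qed

section \<open>The characteristic polynomial of a matrix with zero diagonal\<close>

definition with_diagonal :: "real \<Rightarrow> ('q \<times> 'q \<Rightarrow> real) \<Rightarrow> 'q \<Rightarrow> 'q \<Rightarrow> real" where
  "with_diagonal d M p q = (if p = q then d else M (p, q))"

definition inverse_matrices :: "'q set \<Rightarrow> ('q \<Rightarrow> 'q \<Rightarrow> real) \<Rightarrow> ('q \<Rightarrow> 'q \<Rightarrow> real) \<Rightarrow> bool" where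
  "inverse_matrices Q H N \<longleftrightarrow> (\<forall>p\<in>Q. \<forall>q\<in>Q.
     (\<Sum>r\<in>Q. H p r * N r q) = (if p = q then 1 else 0) \<and>
     (\<Sum>r\<in>Q. N p r * H r q) = (if p = q then 1 else 0))"

text \<open>In the Leibniz expansion of the determinant of the matrix with diagonal \<open>- \<mu>\<close>, a
  permutation contributes \<open>- \<mu>\<close> to the power of its number of fixed points, times off-diagonal
  entries. Only the identity fixes all points. Up to sign the determinant is therefore monic in
  \<open>\<mu>\<close>, with coefficients that are polynomials in the off-diagonal entries. The determinant is
  written as a relation between \<open>\<mu>\<close> and these entries so that the index set may be any finite set.\<close>

lemma characteristic_relation:
  fixes Q :: "'q set"
  assumes "finite Q"
  shows "\<exists>c. (\<forall>l<card Q. polynomial_fun {(p, q). p \<in> Q \<and> q \<in> Q \<and> p \<noteq> q} (c l)) \<and>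
    (\<forall>M \<mu>. \<mu> ^ card Q \<noteq> (\<Sum>l<card Q. c l M * \<mu> ^ l) \<longrightarrow>
      (\<exists>N. inverse_matrices Q (with_diagonal (- \<mu>) M) N))"
proof -
  define m where "m = card Q"
  obtain h where h: "bij_betw h {0..<m} Q"
    using ex_bij_betw_nat_finite[OF assms] by (auto simp: m_def)
  have hQ: "h i \<in> Q" if "i < m" for i using h that by (auto simp: bij_betw_def)
  have h_inj: "h i = h j \<longleftrightarrow> i = j" if "i < m" "j < m" for i j
    using h that by (auto simp: bij_betw_def inj_on_def)
  define P where "P = {\<pi>. \<pi> permutes {0..<m}} - {id}"
  define fixed where "fixed = (\<lambda>\<pi>. card {i\<in>{0..<m}. \<pi> i = i})"
  define g where "g = (\<lambda>\<pi> (M :: 'q \<times> 'q \<Rightarrow> real).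
    signof \<pi> * (- 1) ^ fixed \<pi> * (\<Prod>i\<in>{i\<in>{0..<m}. \<pi> i \<noteq> i}. M (h i, h (\<pi> i))))"
  define c where "c = (\<lambda>l M. - ((- 1) ^ m) * (\<Sum>\<pi>\<in>{\<pi>\<in>P. fixed \<pi> = l}. g \<pi> M))"
  have finP: "finite P" unfolding P_def by (simp add: finite_permutations)
  have fixed_less: "fixed \<pi> < m" if "\<pi> \<in> P" for \<pi>
  proof -
    have \<pi>: "\<pi> \<noteq> id" "\<pi> permutes {0..<m}" using that by (simp_all add: P_def)
    then obtain i where i: "\<pi> i \<noteq> i" by (metis eq_id_iff)
    then have "i \<in> {0..<m}" using \<pi>(2) permutes_not_in by metis
    moreover have "{l\<in>{0..<m}. \<pi> l = l} \<subseteq> {0..<m} - {i}" using i by blast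
    then have "fixed \<pi> \<le> card ({0..<m} - {i})" unfolding fixed_def by (intro card_mono) auto
    ultimately show ?thesis by simp
  qed
  have "polynomial_fun {(p, q). p \<in> Q \<and> q \<in> Q \<and> p \<noteq> q} (c l)" for l
    unfolding c_def g_def
  proof (intro polynomial_fun.mult polynomial_fun.const polynomial_fun_sum polynomial_fun_prod
      polynomial_fun.coord)
    fix \<pi> i assume "\<pi> \<in> {\<pi>\<in>P. fixed \<pi> = l}" "i \<in> {i\<in>{0..<m}. \<pi> i \<noteq> i}"
    then have "\<pi> i < m" "\<pi> i \<noteq> i" "i < m"
      using permutes_in_image[of \<pi> "{0..<m}" i] by (auto simp: P_def)
    then show "(h i, h (\<pi> i)) \<in> {(p, q). p \<in> Q \<and> q \<in> Q \<and> p \<noteq> q}"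
      using hQ h_inj by auto
  qed (use finP in auto)
  moreover have "\<exists>N. inverse_matrices Q (with_diagonal (- \<mu>) M) N"
    if ne: "\<mu> ^ m \<noteq> (\<Sum>l<m. c l M * \<mu> ^ l)" for M \<mu>
  proof -
    define S where "S = with_diagonal (- \<mu>) M"
    define A where "A = mat m m (\<lambda>(i, j). S (h i) (h j))"
    have A: "A \<in> carrier_mat m m" by (simp add: A_def)
    have summand: "signof \<pi> * (\<Prod>i = 0..<m. A $$ (i, \<pi> i)) = g \<pi> M * \<mu> ^ fixed \<pi>"
      if "\<pi> permutes {0..<m}" for \<pi>
    proof -
      have in_range: "\<pi> i < m" if "i < m" for i
        using permutes_in_image[OF \<open>\<pi> permutes {0..<m}\<close>, of i] that by auto
      have "(\<Prod>i = 0..<m. A $$ (i, \<pi> i)) =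
          (\<Prod>i = 0..<m. if \<pi> i = i then - \<mu> else M (h i, h (\<pi> i)))"
        using in_range h_inj by (intro prod.cong) (auto simp: A_def S_def with_diagonal_def)
      also have "\<dots> = (\<Prod>i\<in>{i\<in>{0..<m}. \<pi> i = i}. - \<mu>) *
          (\<Prod>i\<in>{i\<in>{0..<m}. \<pi> i \<noteq> i}. M (h i, h (\<pi> i)))"
        by (subst prod.If_cases) (auto simp: Int_def Collect_neg_eq[symmetric])
      also have "(\<Prod>i\<in>{i\<in>{0..<m}. \<pi> i = i}. - \<mu>) = (- 1) ^ fixed \<pi> * \<mu> ^ fixed \<pi>"
        by (simp add: fixed_def power_minus[of \<mu>])
      finally show ?thesis by (simp add: g_def mult_ac)
    qed
    have perms: "{\<pi>. \<pi> permutes {0..<m}} = insert id P" "id \<notin> P"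
      by (auto simp: P_def permutes_id)
    have "(\<Sum>\<pi>\<in>P. g \<pi> M * \<mu> ^ fixed \<pi>) =
        (\<Sum>l<m. \<Sum>\<pi>\<in>{\<pi>\<in>P. fixed \<pi> = l}. g \<pi> M * \<mu> ^ fixed \<pi>)"
      using fixed_less finP by (intro sum.group[symmetric]) auto
    also have "\<dots> = (\<Sum>l<m. - ((- 1) ^ m) * (c l M * \<mu> ^ l))"
    proof (intro sum.cong refl)
      fix l
      have "- ((- 1) ^ m) * (c l M * \<mu> ^ l) =
          ((- 1) ^ m * (- 1) ^ m) * ((\<Sum>\<pi>\<in>{\<pi>\<in>P. fixed \<pi> = l}. g \<pi> M) * \<mu> ^ l)"
        unfolding c_def by (simp only: mult_ac minus_mult_left[symmetric] minus_mult_right[symmetric] minus_minus)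
      also have "(- 1 :: real) ^ m * (- 1) ^ m = 1" by (simp flip: power_mult_distrib)
      finally show "(\<Sum>\<pi>\<in>{\<pi>\<in>P. fixed \<pi> = l}. g \<pi> M * \<mu> ^ fixed \<pi>) =
          - ((- 1) ^ m) * (c l M * \<mu> ^ l)"
        by (simp add: sum_distrib_right)
    qed
    also have "\<dots> = - ((- 1) ^ m) * (\<Sum>l<m. c l M * \<mu> ^ l)"
      by (rule sum_distrib_left[symmetric])
    finally have P: "(\<Sum>\<pi>\<in>P. g \<pi> M * \<mu> ^ fixed \<pi>) =
        - ((- 1) ^ m) * (\<Sum>l<m. c l M * \<mu> ^ l)" .
    have "det A = (\<Sum>\<pi>\<in>insert id P. g \<pi> M * \<mu> ^ fixed \<pi>)"
      unfolding det_def'[OF A] perms(1)[symmetric] by (intro sum.cong) (auto simp: summand)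
    also have "\<dots> = (- 1) ^ m * \<mu> ^ m - (- 1) ^ m * (\<Sum>l<m. c l M * \<mu> ^ l)"
      using perms(2) finP P by (simp add: g_def fixed_def)
    finally have "det A = (- 1) ^ m * (\<mu> ^ m - (\<Sum>l<m. c l M * \<mu> ^ l))"
      by (simp add: right_diff_distrib)
    then have det: "det A \<noteq> 0" using ne by simp
    define B where "B = adj_mat A"
    have B: "B \<in> carrier_mat m m" using adj_mat(1)[OF A] by (simp add: B_def)
    define ix where "ix = the_inv_into {0..<m} h"
    have ix: "ix p < m" "h (ix p) = p" if "p \<in> Q" for p
      using that h the_inv_into_into[of h "{0..<m}" p "{0..<m}"] f_the_inv_into_f[of h "{0..<m}" p]
      by (auto simp: ix_def bij_betw_def)
    have ix_h: "ix (h i) = i" if "i < m" for i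
      using that h by (auto simp: ix_def bij_betw_def the_inv_into_f_f)
    define N where "N = (\<lambda>r q. B $$ (ix r, ix q) / det A)"
    have "(\<Sum>r\<in>Q. S p r * N r q) = (if p = q then 1 else 0) \<and>
      (\<Sum>r\<in>Q. N p r * S r q) = (if p = q then 1 else 0)" if pq: "p \<in> Q" "q \<in> Q" for p q
    proof -
      have eq: "ix p = ix q \<longleftrightarrow> p = q" using ix pq by metis
      have "(\<Sum>r\<in>Q. S p r * N r q) = (\<Sum>i\<in>{0..<m}. S p (h i) * N (h i) q)"
        by (rule sum.reindex_bij_betw[OF h, symmetric])
      also have "\<dots> = (A * B) $$ (ix p, ix q) / det A"
        using A B ix pq
        by (simp add: scalar_prod_def N_def ix_h sum_divide_distrib A_def)
      also have "\<dots> = (if p = q then 1 else 0)"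
        using adj_mat(2)[OF A] ix pq det eq by (simp add: B_def)
      finally have 1: "(\<Sum>r\<in>Q. S p r * N r q) = (if p = q then 1 else 0)" .
      have "(\<Sum>r\<in>Q. N p r * S r q) = (\<Sum>i\<in>{0..<m}. N p (h i) * S (h i) q)"
        by (rule sum.reindex_bij_betw[OF h, symmetric])
      also have "\<dots> = (B * A) $$ (ix p, ix q) / det A"
        using A B ix pq
        by (simp add: scalar_prod_def N_def ix_h sum_divide_distrib A_def)
      also have "\<dots> = (if p = q then 1 else 0)"
        using adj_mat(3)[OF A] ix pq det eq by (simp add: B_def)
      finally show ?thesis using 1 by simp
    qed
    then show ?thesis unfolding S_def inverse_matrices_def by (intro exI[of _ N]) blast
  qed
  ultimately show ?thesis unfolding m_def by blast
qed

section \<open>Gradient of a multilinear form on a product of spheres\<close>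

text \<open>This is \<open>tensor_form\<close> as a multilinear form. Its arguments are curried so that a single
  vector can be exchanged by a function update.\<close>

definition contract ::
  "nat \<Rightarrow> (nat \<Rightarrow> nat) \<Rightarrow> ((nat \<Rightarrow> nat) \<Rightarrow> real) \<Rightarrow> (nat \<Rightarrow> nat \<Rightarrow> real) \<Rightarrow> real" where
  "contract k n A f = (\<Sum>\<iota>\<in>tensor_indices k n. A \<iota> * (\<Prod>j\<in>{1..k}. f j (\<iota> j)))"

lemma finite_tensor_indices: "finite (tensor_indices k n)"
  unfolding tensor_indices_def by (auto intro!: finite_PiE)

lemma tensor_index_range:
  "\<iota> \<in> tensor_indices k n \<Longrightarrow> j \<in> {1..k} \<Longrightarrow> \<iota> j \<in> {1..n j}"
  unfolding tensor_indices_def by (rule PiE_mem)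

lemma tensor_form_eq_contract: "tensor_form k n A x = contract k n A (curry x)"
  unfolding tensor_form_def contract_def ip_def rank_one_def by (intro sum.cong) auto

lemma contract_cong:
  assumes "\<And>j i. j \<in> {1..k} \<Longrightarrow> i \<in> {1..n j} \<Longrightarrow> f j i = g j i"
  shows "contract k n A f = contract k n A g"
  unfolding contract_def
proof (intro sum.cong refl arg_cong2[of _ _ _ _ times] prod.cong)
  fix \<iota> j assume "\<iota> \<in> tensor_indices k n" "j \<in> {1..k}"
  then show "f j (\<iota> j) = g j (\<iota> j)" using assms tensor_index_range by blast
qed

lemma contract_slot_sum:
  assumes "j \<in> {1..k}"
  shows "contract k n A (f(j := (\<lambda>i. \<Sum>s\<in>S. c s * g s i))) = (\<Sum>s\<in>S. c s * contract k n A (f(j := g s)))"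
proof -
  have split: "(\<Prod>l\<in>{1..k}. (f(j := h)) l (\<iota> l)) = h (\<iota> j) * (\<Prod>l\<in>{1..k} - {j}. f l (\<iota> l))" for h \<iota>
    using assms by (subst prod.remove[of _ j]) auto
  have "contract k n A (f(j := (\<lambda>i. \<Sum>s\<in>S. c s * g s i))) =
      (\<Sum>\<iota>\<in>tensor_indices k n. \<Sum>s\<in>S.
        c s * (A \<iota> * (g s (\<iota> j) * (\<Prod>l\<in>{1..k} - {j}. f l (\<iota> l)))))"
    unfolding contract_def split by (simp add: sum_distrib_left sum_distrib_right mult_ac)
  also have "\<dots> = (\<Sum>s\<in>S. c s * contract k n A (f(j := g s)))"
    by (subst sum.swap) (simp only: contract_def split sum_distrib_left)
  finally show ?thesis .
qed

lemma contract_slot_zero: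
  assumes "j \<in> {1..k}" "\<And>i. i \<in> {1..n j} \<Longrightarrow> f j i = 0"
  shows "contract k n A f = 0"
proof -
  have "contract k n A f = contract k n A (f(j := (\<lambda>i. \<Sum>s\<in>{}. 1 * f j i)))"
    using assms by (intro contract_cong) auto
  then show ?thesis unfolding contract_slot_sum[OF assms(1)] by simp
qed

definition unit_vec_fun :: "nat \<Rightarrow> nat \<Rightarrow> real" where
  "unit_vec_fun i = (\<lambda>i'. if i' = i then 1 else 0)"

lemma contract_slot_coords:
  assumes "j \<in> {1..k}"
  shows "contract k n A (f(j := g)) = (\<Sum>i\<in>{1..n j}. g i * contract k n A (f(j := unit_vec_fun i)))"
proof -
  have "contract k n A (f(j := g)) =
      contract k n A (f(j := (\<lambda>i'. \<Sum>i\<in>{1..n j}. g i * unit_vec_fun i i')))"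
    by (intro contract_cong) (auto simp: unit_vec_fun_def if_distrib[of "times _"] sum.delta cong: if_cong)
  then show ?thesis unfolding contract_slot_sum[OF assms] .
qed

lemma contract_has_derivative:
  assumes "\<And>j i. j \<in> {1..k} \<Longrightarrow> i \<in> {1..n j} \<Longrightarrow> ((\<lambda>t. f t j i) has_real_derivative g j i) (at 0)"
  shows "((\<lambda>t. contract k n A (f t)) has_real_derivative
    (\<Sum>j\<in>{1..k}. contract k n A ((f 0)(j := g j)))) (at 0)"
proof -
  have "((\<lambda>t. contract k n A (f t)) has_real_derivative
    (\<Sum>\<iota>\<in>tensor_indices k n. A \<iota> *
      (\<Sum>j\<in>{1..k}. g j (\<iota> j) * (\<Prod>l\<in>{1..k} - {j}. f 0 l (\<iota> l))))) (at 0)"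
    unfolding contract_def
  proof (intro DERIV_sum DERIV_cmult has_field_derivative_prod)
    fix \<iota> j assume "\<iota> \<in> tensor_indices k n" "j \<in> {1..k}"
    then show "((\<lambda>t. f t j (\<iota> j)) has_real_derivative g j (\<iota> j)) (at 0)"
      using assms tensor_index_range by blast
  qed
  also have "(\<Sum>\<iota>\<in>tensor_indices k n. A \<iota> *
      (\<Sum>j\<in>{1..k}. g j (\<iota> j) * (\<Prod>l\<in>{1..k} - {j}. f 0 l (\<iota> l)))) =
    (\<Sum>j\<in>{1..k}. \<Sum>\<iota>\<in>tensor_indices k n. A \<iota> *
      (g j (\<iota> j) * (\<Prod>l\<in>{1..k} - {j}. f 0 l (\<iota> l))))"
    by (subst sum.swap) (simp add: sum_distrib_left)
  also have "\<dots> = (\<Sum>j\<in>{1..k}. contract k n A ((f 0)(j := g j)))"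
    unfolding contract_def
    by (intro sum.cong refl arg_cong2[of _ _ _ _ times]) (subst prod.remove[of _ _], auto)
  finally show ?thesis .
qed

lemma ip_tuple:
  "ip (tuple_indices k n) v w = (\<Sum>j\<in>{1..k}. \<Sum>i\<in>{1..n j}. v (j, i) * w (j, i))"
  unfolding ip_def tuple_indices_def by (subst sum.Sigma) (auto intro!: sum.cong)

text \<open>The tangent vectors are exactly those orthogonal to every \<open>x\<^sub>j\<close>. A curve with a given such
  velocity \<open>v\<close> comes from the straight line \<open>x + t v\<close> by normalizing each factor; orthogonality makes
  the norm of the \<open>j\<close>-th factor of the line equal to \<open>sqrt (1 + t\<^sup>2 V\<^sub>j)\<close>, which is never zero and is
  constant to first order at \<open>t = 0\<close>.\<close>

lemma tangent_sphere_product: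
  assumes x: "x \<in> sphere_product k n"
  shows "tangent_space (sphere_product k n) x =
    {v \<in> coord_space (tuple_indices k n). \<forall>j\<in>{1..k}. (\<Sum>i\<in>{1..n j}. x (j, i) * v (j, i)) = 0}"
    (is "_ = ?T")
proof (intro Set.equalityI subsetI)
  fix v assume "v \<in> tangent_space (sphere_product k n) x"
  then obtain \<gamma> where \<gamma>: "\<And>t. \<gamma> t \<in> sphere_product k n" "\<gamma> 0 = x"
      "\<And>p. ((\<lambda>t. \<gamma> t p) has_real_derivative v p) (at 0)"
    by (auto simp: tangent_space_def curve_through_def has_velocity_def)
  have "v p = 0" if "p \<notin> tuple_indices k n" for p
  proof -
    have "(\<lambda>t. \<gamma> t p) = (\<lambda>t. 0)"
      using \<gamma>(1) that by (cases p) (auto simp: sphere_product_def coord_space_def)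
    then show ?thesis using \<gamma>(3)[of p] DERIV_unique[of "\<lambda>t. 0 :: real" "v p" 0 0] by auto
  qed
  moreover have "(\<Sum>i\<in>{1..n j}. x (j, i) * v (j, i)) = 0" if j: "j \<in> {1..k}" for j
  proof -
    have "((\<lambda>t. \<Sum>i\<in>{1..n j}. (\<gamma> t (j, i))\<^sup>2) has_real_derivative
        (\<Sum>i\<in>{1..n j}. 2 * (x (j, i) * v (j, i)))) (at 0)"
      by (intro DERIV_sum) (auto intro!: derivative_eq_intros \<gamma>(3) simp: \<gamma>(2))
    moreover have "(\<lambda>t. \<Sum>i\<in>{1..n j}. (\<gamma> t (j, i))\<^sup>2) = (\<lambda>t. 1)"
      using \<gamma>(1) j by (auto simp: sphere_product_def)
    ultimately have "(\<Sum>i\<in>{1..n j}. 2 * (x (j, i) * v (j, i))) = 0"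
      using DERIV_unique[of "\<lambda>t. 1 :: real" _ 0 0] by auto
    then show ?thesis by (simp add: sum_distrib_left[symmetric])
  qed
  ultimately show "v \<in> ?T" by (auto simp: coord_space_def)
next
  fix v assume v: "v \<in> ?T"
  define V where "V = (\<lambda>j. \<Sum>i\<in>{1..n j}. (v (j, i))\<^sup>2)"
  have V: "V j \<ge> 0" for j by (simp add: V_def sum_nonneg)
  define \<gamma> where "\<gamma> = (\<lambda>t p. (x p + t * v p) / sqrt (1 + t\<^sup>2 * V (fst p)))"
  have pos: "1 + t\<^sup>2 * V j > 0" for t j using V[of j] by (simp add: add_pos_nonneg)
  have "\<gamma> t \<in> sphere_product k n" for t
    unfolding sphere_product_def
  proof (intro CollectI conjI ballI)
    show "\<gamma> t \<in> coord_space (tuple_indices k n)"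
      using x v by (auto simp: \<gamma>_def sphere_product_def coord_space_def)
    fix j assume j: "j \<in> {1..k}"
    have "(\<Sum>i\<in>{1..n j}. (x (j, i) + t * v (j, i))\<^sup>2) =
        (\<Sum>i\<in>{1..n j}. (x (j, i))\<^sup>2) + 2 * t * (\<Sum>i\<in>{1..n j}. x (j, i) * v (j, i)) + t\<^sup>2 * V j"
      by (simp add: V_def sum_distrib_left sum.distrib[symmetric] power2_eq_square algebra_simps)
    also have "\<dots> = 1 + t\<^sup>2 * V j" using x v j by (auto simp: sphere_product_def)
    finally show "(\<Sum>i\<in>{1..n j}. (\<gamma> t (j, i))\<^sup>2) = 1"
      using pos[of t j] by (simp add: \<gamma>_def power_divide sum_divide_distrib[symmetric])
  qed
  moreover have "has_velocity \<gamma> v"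
    unfolding has_velocity_def \<gamma>_def by (auto intro!: derivative_eq_intros)
  ultimately have "curve_through (sphere_product k n) x v \<gamma>"
    by (simp add: curve_through_def \<gamma>_def)
  then show "v \<in> tangent_space (sphere_product k n) x" by (auto simp: tangent_space_def)
qed

lemma tangent_vector_eqI:
  assumes x: "x \<in> sphere_product k n"
    and T: "v \<in> tangent_space (sphere_product k n) x" "w \<in> tangent_space (sphere_product k n) x"
    and eq: "\<And>u. u \<in> tangent_space (sphere_product k n) x \<Longrightarrow>
      ip (tuple_indices k n) v u = ip (tuple_indices k n) w u"
  shows "v = w"
proof -
  define u where "u = (\<lambda>p. v p - w p)"
  have "u \<in> tangent_space (sphere_product k n) x"
    using T unfolding tangent_sphere_product[OF x]
    by (auto simp: u_def coord_space_def right_diff_distrib sum_subtractf)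
  then have "ip (tuple_indices k n) u u = 0"
    using eq[of u] by (simp add: ip_def u_def left_diff_distrib sum_subtractf)
  moreover have "finite (tuple_indices k n)" by (auto simp: tuple_indices_def)
  ultimately have "u p = 0" if "p \<in> tuple_indices k n" for p
    using that by (auto simp: ip_def sum_nonneg_eq_0_iff)
  moreover have "u p = 0" if "p \<notin> tuple_indices k n" for p
    using T that unfolding tangent_sphere_product[OF x] by (cases p) (auto simp: u_def coord_space_def)
  ultimately show ?thesis by (auto simp: u_def fun_eq_iff)
qed

lemma tensor_form_has_derivative:
  assumes "curve_through (sphere_product k n) x v \<gamma>"
  shows "((\<lambda>t. tensor_form k n A (\<gamma> t)) has_real_derivative
    (\<Sum>j\<in>{1..k}. contract k n A ((curry x)(j := curry v j)))) (at 0)"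
proof -
  have "((\<lambda>t. curry (\<gamma> t) j i) has_real_derivative curry v j i) (at 0)" for j i
    using assms by (auto simp: curve_through_def has_velocity_def)
  from contract_has_derivative[of k n "\<lambda>t. curry (\<gamma> t)" "curry v", OF this]
  show ?thesis using assms by (simp add: tensor_form_eq_contract curve_through_def)
qed

text \<open>The Euclidean gradient minus its radial part. By Euler's identity for the linear slot \<open>j\<close>,
  the radial coefficient in each factor, at a tuple of unit vectors, is the value of the form itself. As an explicit formula it can
  be differentiated along a curve.\<close>

definition tangential_gradient ::
  "nat \<Rightarrow> (nat \<Rightarrow> nat) \<Rightarrow> ((nat \<Rightarrow> nat) \<Rightarrow> real) \<Rightarrow> (nat \<times> nat \<Rightarrow> real) \<Rightarrow> nat \<times> nat \<Rightarrow> real" where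
  "tangential_gradient k n A y = (\<lambda>(j, i). if (j, i) \<in> tuple_indices k n then
     contract k n A ((curry y)(j := unit_vec_fun i)) - contract k n A (curry y) * y (j, i) else 0)"

lemma riem_grad_tensor_form:
  assumes y: "y \<in> sphere_product k n"
  shows "riem_grad (tuple_indices k n) (sphere_product k n) (tensor_form k n A) y =
    tangential_gradient k n A y"
  unfolding riem_grad_def
proof (rule the_equality)
  let ?T = "tangent_space (sphere_product k n) y" and ?g = "tangential_gradient k n A y"
  have g: "?g (j, i) = contract k n A ((curry y)(j := unit_vec_fun i)) - contract k n A (curry y) * y (j, i)"
    if "j \<in> {1..k}" "i \<in> {1..n j}" for j i
    using that by (simp add: tangential_gradient_def tuple_indices_def)
  have gT: "?g \<in> ?T"
    unfolding tangent_sphere_product[OF y]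
  proof (intro CollectI conjI ballI)
    show "?g \<in> coord_space (tuple_indices k n)"
      by (auto simp: coord_space_def tangential_gradient_def)
    fix j assume j: "j \<in> {1..k}"
    have "(\<Sum>i\<in>{1..n j}. y (j, i) * ?g (j, i)) =
        (\<Sum>i\<in>{1..n j}. y (j, i) * contract k n A ((curry y)(j := unit_vec_fun i))) -
        contract k n A (curry y) * (\<Sum>i\<in>{1..n j}. (y (j, i))\<^sup>2)"
      by (simp add: g[OF j] right_diff_distrib sum_subtractf sum_distrib_left power2_eq_square mult_ac)
    also have "(\<Sum>i\<in>{1..n j}. y (j, i) * contract k n A ((curry y)(j := unit_vec_fun i))) =
        contract k n A (curry y)"
      using contract_slot_coords[OF j, of n A "curry y" "curry y j"] by (simp only: fun_upd_triv curry_conv)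
    also have "(\<Sum>i\<in>{1..n j}. (y (j, i))\<^sup>2) = 1" using y j by (auto simp: sphere_product_def)
    finally show "(\<Sum>i\<in>{1..n j}. y (j, i) * ?g (j, i)) = 0" by simp
  qed
  have deriv: "((\<lambda>t. tensor_form k n A (\<gamma> t)) has_real_derivative ip (tuple_indices k n) ?g v) (at 0)"
    if \<gamma>: "curve_through (sphere_product k n) y v \<gamma>" for v \<gamma>
  proof -
    have "v \<in> ?T" using \<gamma> by (auto simp: tangent_space_def)
    then have v: "(\<Sum>i\<in>{1..n j}. y (j, i) * v (j, i)) = 0" if "j \<in> {1..k}" for j
      using that unfolding tangent_sphere_product[OF y] by auto
    have "ip (tuple_indices k n) ?g v = (\<Sum>j\<in>{1..k}. contract k n A ((curry y)(j := curry v j)))"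
      unfolding ip_tuple
    proof (intro sum.cong refl)
      fix j assume j: "j \<in> {1..k}"
      have "(\<Sum>i\<in>{1..n j}. ?g (j, i) * v (j, i)) =
          (\<Sum>i\<in>{1..n j}. v (j, i) * contract k n A ((curry y)(j := unit_vec_fun i))) -
          contract k n A (curry y) * (\<Sum>i\<in>{1..n j}. y (j, i) * v (j, i))"
        by (simp add: g[OF j] algebra_simps sum_subtractf sum_distrib_left)
      then show "(\<Sum>i\<in>{1..n j}. ?g (j, i) * v (j, i)) = contract k n A ((curry y)(j := curry v j))"
        unfolding contract_slot_coords[OF j, of n A "curry y" "curry v j"] v[OF j] by simp
    qed
    then show ?thesis using tensor_form_has_derivative[OF \<gamma>, of A] by simp
  qed
  show "?g \<in> ?T \<and> (\<forall>v \<gamma>. curve_through (sphere_product k n) y v \<gamma> \<longrightarrow>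
      ((\<lambda>t. tensor_form k n A (\<gamma> t)) has_real_derivative ip (tuple_indices k n) ?g v) (at 0))"
    using gT deriv by blast
  fix h assume h: "h \<in> ?T \<and> (\<forall>v \<gamma>. curve_through (sphere_product k n) y v \<gamma> \<longrightarrow>
      ((\<lambda>t. tensor_form k n A (\<gamma> t)) has_real_derivative ip (tuple_indices k n) h v) (at 0))"
  show "h = ?g"
  proof (rule tangent_vector_eqI[OF y])
    fix v assume "v \<in> ?T"
    then obtain \<gamma> where "curve_through (sphere_product k n) y v \<gamma>" by (auto simp: tangent_space_def)
    with h deriv show "ip (tuple_indices k n) h v = ip (tuple_indices k n) ?g v"
      by (blast intro: DERIV_unique)
  qed (use h gT in auto)
qed

section \<open>Hessian in an adapted orthonormal frame\<close>

definition tangent_indices :: "nat \<Rightarrow> (nat \<Rightarrow> nat) \<Rightarrow> (nat \<times> nat) set" where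
  "tangent_indices k n = (SIGMA j:{1..k}. {2..n j})"

text \<open>In every factor, the columns \<open>a\<close> of the orthogonal matrix \<open>U j\<close> form an orthonormal basis that
  starts with \<open>x\<^sub>j\<close>. The columns \<open>a \<ge> 2\<close> of all factors then form an orthonormal basis of the
  tangent space, indexed by \<open>tangent_indices\<close>.\<close>

locale adapted_frame =
  fixes k :: nat and n :: "nat \<Rightarrow> nat" and x :: "nat \<times> nat \<Rightarrow> real"
    and U :: "nat \<Rightarrow> nat \<Rightarrow> nat \<Rightarrow> real"
  assumes x: "x \<in> sphere_product k n"
    and dim_pos: "\<And>j. j \<in> {1..k} \<Longrightarrow> 1 \<le> n j"
    and columns: "\<And>j a b. j \<in> {1..k} \<Longrightarrow> a \<in> {1..n j} \<Longrightarrow> b \<in> {1..n j} \<Longrightarrow>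
      (\<Sum>i\<in>{1..n j}. U j i a * U j i b) = (if a = b then 1 else 0)"
    and rows: "\<And>j i i'. j \<in> {1..k} \<Longrightarrow> i \<in> {1..n j} \<Longrightarrow> i' \<in> {1..n j} \<Longrightarrow>
      (\<Sum>a\<in>{1..n j}. U j i a * U j i' a) = (if i = i' then 1 else 0)"
    and first_column: "\<And>j i. j \<in> {1..k} \<Longrightarrow> i \<in> {1..n j} \<Longrightarrow> U j i 1 = x (j, i)"
begin

abbreviation "T \<equiv> tangent_space (sphere_product k n) x"

abbreviation "Q \<equiv> tangent_indices k n"

text \<open>\<open>coef\<close> and \<open>synth\<close> pass between vectors and their coordinates in this basis of the tangent
  space.\<close>

definition coef :: "(nat \<times> nat \<Rightarrow> real) \<Rightarrow> nat \<times> nat \<Rightarrow> real" where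
  "coef v = (\<lambda>(j, a). \<Sum>i\<in>{1..n j}. v (j, i) * U j i a)"

definition synth :: "(nat \<times> nat \<Rightarrow> real) \<Rightarrow> nat \<times> nat \<Rightarrow> real" where
  "synth c = (\<lambda>(j, i). if (j, i) \<in> tuple_indices k n then \<Sum>a\<in>{2..n j}. c (j, a) * U j i a else 0)"

lemma finite_Q: "finite Q" by (auto simp: tangent_indices_def)

lemma tangent_iff:
  "v \<in> T \<longleftrightarrow> v \<in> coord_space (tuple_indices k n) \<and>
    (\<forall>j\<in>{1..k}. (\<Sum>i\<in>{1..n j}. x (j, i) * v (j, i)) = 0)"
  unfolding tangent_sphere_product[OF x] by simp

lemma synth_at: "j \<in> {1..k} \<Longrightarrow> i \<in> {1..n j} \<Longrightarrow> synth c (j, i) = (\<Sum>a\<in>{2..n j}. c (j, a) * U j i a)"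
  by (simp add: synth_def tuple_indices_def)

lemma synth_cong: "(\<And>q. q \<in> Q \<Longrightarrow> c q = d q) \<Longrightarrow> synth c = synth d"
  unfolding synth_def by (intro ext) (auto simp: tangent_indices_def tuple_indices_def intro!: sum.cong)

lemma sum_synth_column:
  assumes j: "j \<in> {1..k}" and b: "b \<in> {1..n j}"
  shows "(\<Sum>i\<in>{1..n j}. synth c (j, i) * U j i b) = (if b = 1 then 0 else c (j, b))"
proof -
  have "(\<Sum>i\<in>{1..n j}. synth c (j, i) * U j i b) =
      (\<Sum>i\<in>{1..n j}. \<Sum>a\<in>{2..n j}. c (j, a) * (U j i a * U j i b))"
    by (intro sum.cong refl) (simp only: synth_at[OF j] sum_distrib_right mult.assoc)
  also have "\<dots> = (\<Sum>a\<in>{2..n j}. c (j, a) * (\<Sum>i\<in>{1..n j}. U j i a * U j i b))"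
    by (subst sum.swap) (simp only: sum_distrib_left)
  also have "\<dots> = (\<Sum>a\<in>{2..n j}. c (j, a) * (if a = b then 1 else 0))"
    using b by (intro sum.cong refl arg_cong2[of _ _ _ _ times] columns[OF j]) auto
  also have "\<dots> = (if b = 1 then 0 else c (j, b))"
    using b by (auto simp: if_distrib[of "times _"] sum.delta cong: if_cong)
  finally show ?thesis .
qed

lemma coef_synth: "q \<in> Q \<Longrightarrow> coef (synth c) q = c q"
  using sum_synth_column[of "fst q" "snd q" c] by (cases q) (auto simp: coef_def tangent_indices_def)

lemma synth_in_T: "synth c \<in> T"
  unfolding tangent_iff
proof (intro conjI ballI)
  show "synth c \<in> coord_space (tuple_indices k n)" by (auto simp: coord_space_def synth_def)
  fix j assume j: "j \<in> {1..k}"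
  have "(\<Sum>i\<in>{1..n j}. x (j, i) * synth c (j, i)) = (\<Sum>i\<in>{1..n j}. synth c (j, i) * U j i 1)"
    by (intro sum.cong refl) (simp only: first_column[OF j] mult.commute)
  then show "(\<Sum>i\<in>{1..n j}. x (j, i) * synth c (j, i)) = 0"
    using sum_synth_column[OF j, of 1 c] dim_pos[OF j] by simp
qed

lemma synth_coef:
  assumes v: "v \<in> T"
  shows "synth (coef v) = v"
proof
  fix p :: "nat \<times> nat"
  obtain j i where p: "p = (j, i)" by (cases p)
  show "synth (coef v) p = v p"
  proof (cases "p \<in> tuple_indices k n")
    case True
    then have j: "j \<in> {1..k}" and i: "i \<in> {1..n j}" by (auto simp: p tuple_indices_def)
    have first: "coef v (j, 1) = 0"
    proof -
      have "coef v (j, 1) = (\<Sum>i\<in>{1..n j}. x (j, i) * v (j, i))"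
        unfolding coef_def prod.case
        by (intro sum.cong refl) (simp only: first_column[OF j] mult.commute)
      then show ?thesis using v j unfolding tangent_iff by simp
    qed
    have "{1..n j} = insert 1 {2..n j}" using dim_pos[OF j] by auto
    then have "(\<Sum>a\<in>{1..n j}. coef v (j, a) * U j i a) = (\<Sum>a\<in>{2..n j}. coef v (j, a) * U j i a)"
      using first by simp
    then have "synth (coef v) p = (\<Sum>a\<in>{1..n j}. coef v (j, a) * U j i a)"
      unfolding p synth_at[OF j i] by simp
    also have "\<dots> = (\<Sum>a\<in>{1..n j}. \<Sum>l\<in>{1..n j}. v (j, l) * (U j l a * U j i a))"
      by (simp add: coef_def sum_distrib_right mult.assoc)
    also have "\<dots> = (\<Sum>l\<in>{1..n j}. v (j, l) * (\<Sum>a\<in>{1..n j}. U j l a * U j i a))"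
      by (subst sum.swap) (simp only: sum_distrib_left)
    also have "\<dots> = (\<Sum>l\<in>{1..n j}. v (j, l) * (if l = i then 1 else 0))"
      by (intro sum.cong refl arg_cong2[of _ _ _ _ times] rows[OF j] i)
    also have "\<dots> = v p" using i by (auto simp: p if_distrib[of "times _"] sum.delta cong: if_cong)
    finally show ?thesis .
  next
    case False
    then show ?thesis using v unfolding tangent_iff by (simp add: synth_def p coord_space_def)
  qed
qed

lemma ip_synth: "ip (tuple_indices k n) w (synth d) = (\<Sum>q\<in>Q. d q * coef w q)"
proof -
  have "ip (tuple_indices k n) w (synth d) =
      (\<Sum>j\<in>{1..k}. \<Sum>i\<in>{1..n j}. \<Sum>a\<in>{2..n j}. d (j, a) * (w (j, i) * U j i a))"
    unfolding ip_tuple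
    by (intro sum.cong refl) (simp only: synth_at sum_distrib_left mult_ac)
  also have "\<dots> = (\<Sum>j\<in>{1..k}. \<Sum>a\<in>{2..n j}. d (j, a) * coef w (j, a))"
    by (rule sum.cong[OF refl], subst sum.swap) (simp add: coef_def sum_distrib_left)
  also have "\<dots> = (\<Sum>q\<in>Q. d q * coef w q)"
    unfolding tangent_indices_def by (subst sum.Sigma) (auto intro!: sum.cong)
  finally show ?thesis .
qed

lemma orth_proj_eq: "orth_proj (tuple_indices k n) T w = synth (coef w)"
  unfolding orth_proj_def
proof (rule the_equality)
  have *: "ip (tuple_indices k n) (\<lambda>p. w p - synth (coef w) p) u = 0" if "u \<in> T" for u
  proof -
    have "coef (\<lambda>p. w p - synth (coef w) p) q = coef w q - coef (synth (coef w)) q" for q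
      by (cases q) (simp add: coef_def left_diff_distrib sum_subtractf)
    then have "ip (tuple_indices k n) (\<lambda>p. w p - synth (coef w) p) (synth (coef u)) = 0"
      unfolding ip_synth by (intro sum.neutral) (simp add: coef_synth)
    then show ?thesis using synth_coef[OF that] by simp
  qed
  then show "synth (coef w) \<in> T \<and> (\<forall>u\<in>T. ip (tuple_indices k n) (\<lambda>p. w p - synth (coef w) p) u = 0)"
    using synth_in_T by blast
  fix p assume p: "p \<in> T \<and> (\<forall>u\<in>T. ip (tuple_indices k n) (\<lambda>i. w i - p i) u = 0)"
  show "p = synth (coef w)"
  proof (rule tangent_vector_eqI[OF x])
    fix u assume "u \<in> T"
    then show "ip (tuple_indices k n) p u = ip (tuple_indices k n) (synth (coef w)) u"
      using * p by (simp add: ip_def left_diff_distrib sum_subtractf)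
  qed (use p synth_in_T in auto)
qed

text \<open>The Hessian in this basis, apart from its diagonal. A multilinear form has no second
  derivative within a single slot, so the blocks on the diagonal receive only the curvature term, minus
  the value of the form times the identity matrix.\<close>

definition hessian_entry :: "((nat \<Rightarrow> nat) \<Rightarrow> real) \<Rightarrow> (nat \<times> nat) \<times> (nat \<times> nat) \<Rightarrow> real" where
  "hessian_entry A = (\<lambda>(p, q).
    (if fst p = fst q then 0
     else contract k n A ((curry x)(fst p := (\<lambda>i. U (fst p) i (snd p)),
                                    fst q := (\<lambda>i. U (fst q) i (snd q))))))"

text \<open>The derivative of \<open>tangential_gradient\<close> along a curve with velocity \<open>v\<close>: the three terms come
  from the second derivatives of the form, from its first derivative in the factor \<open>contract k n A
  (curry y)\<close> and from the velocity of \<open>y\<close> itself. The second one is a multiple of \<open>x\<^sub>j\<close> and disappears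
  under the projection.\<close>

definition gradient_velocity ::
  "((nat \<Rightarrow> nat) \<Rightarrow> real) \<Rightarrow> (nat \<times> nat \<Rightarrow> real) \<Rightarrow> nat \<times> nat \<Rightarrow> real" where
  "gradient_velocity A v = (\<lambda>(j, i). if (j, i) \<in> tuple_indices k n then
     (\<Sum>l\<in>{1..k} - {j}. contract k n A ((curry x)(j := unit_vec_fun i, l := curry v l)))
     - (\<Sum>l\<in>{1..k}. contract k n A ((curry x)(l := curry v l))) * x (j, i)
     - contract k n A (curry x) * v (j, i) else 0)"

lemma has_velocity_gradient:
  assumes \<gamma>: "curve_through (sphere_product k n) x v \<gamma>"
  shows "has_velocity
    (\<lambda>t. riem_grad (tuple_indices k n) (sphere_product k n) (tensor_form k n A) (\<gamma> t))
    (gradient_velocity A v)"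
proof -
  have \<gamma>S: "\<gamma> t \<in> sphere_product k n" for t using \<gamma> by (simp add: curve_through_def)
  have \<gamma>0: "\<gamma> 0 = x" using \<gamma> by (simp add: curve_through_def)
  have vel: "((\<lambda>t. \<gamma> t p) has_real_derivative v p) (at 0)" for p
    using \<gamma> by (cases p) (simp add: curve_through_def has_velocity_def)
  have "((\<lambda>t. tangential_gradient k n A (\<gamma> t) (j, i)) has_real_derivative
      gradient_velocity A v (j, i)) (at 0)" for j i
  proof (cases "(j, i) \<in> tuple_indices k n")
    case True
    then have j: "j \<in> {1..k}" by (simp add: tuple_indices_def)
    define g where "g = (\<lambda>l. if l = j then (\<lambda>_. 0) else curry v l)"
    have "((\<lambda>t. ((curry (\<gamma> t))(j := unit_vec_fun i)) l i') has_real_derivative g l i') (at 0)" for l i'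
      using vel by (auto simp: g_def)
    from contract_has_derivative[of k n "\<lambda>t. (curry (\<gamma> t))(j := unit_vec_fun i)" g, OF this]
    have "((\<lambda>t. contract k n A ((curry (\<gamma> t))(j := unit_vec_fun i))) has_real_derivative
      (\<Sum>l\<in>{1..k}. contract k n A ((curry x)(j := unit_vec_fun i, l := g l)))) (at 0)"
      by (simp add: \<gamma>0)
    also have "(\<Sum>l\<in>{1..k}. contract k n A ((curry x)(j := unit_vec_fun i, l := g l))) =
        contract k n A ((curry x)(j := unit_vec_fun i, j := g j)) +
        (\<Sum>l\<in>{1..k} - {j}. contract k n A ((curry x)(j := unit_vec_fun i, l := g l)))"
      using j by (intro sum.remove) auto
    also have "contract k n A ((curry x)(j := unit_vec_fun i, j := g j)) = 0"
      by (rule contract_slot_zero[OF j]) (simp add: g_def)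
    also have "(\<Sum>l\<in>{1..k} - {j}. contract k n A ((curry x)(j := unit_vec_fun i, l := g l))) =
        (\<Sum>l\<in>{1..k} - {j}. contract k n A ((curry x)(j := unit_vec_fun i, l := curry v l)))"
      by (intro sum.cong) (auto simp: g_def)
    finally have 1: "((\<lambda>t. contract k n A ((curry (\<gamma> t))(j := unit_vec_fun i))) has_real_derivative
        (\<Sum>l\<in>{1..k} - {j}. contract k n A ((curry x)(j := unit_vec_fun i, l := curry v l)))) (at 0)"
      by (simp only: add_0_left)
    have 2: "((\<lambda>t. contract k n A (curry (\<gamma> t))) has_real_derivative
        (\<Sum>l\<in>{1..k}. contract k n A ((curry x)(l := curry v l)))) (at 0)"
      using tensor_form_has_derivative[OF \<gamma>, of A] by (simp add: tensor_form_eq_contract)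
    from DERIV_diff[OF 1 DERIV_mult[OF 2 vel[of "(j, i)"]]] True show ?thesis
      by (simp add: tangential_gradient_def gradient_velocity_def \<gamma>0 algebra_simps)
  qed (simp add: tangential_gradient_def gradient_velocity_def)
  then show ?thesis unfolding has_velocity_def riem_grad_tensor_form[OF \<gamma>S] by (auto simp: split_paired_all)
qed

lemma riem_hessian_eq:
  assumes v: "v \<in> T"
  shows "riem_hessian (tuple_indices k n) (sphere_product k n) (tensor_form k n A) x v =
    synth (coef (gradient_velocity A v))"
  unfolding riem_hessian_def
proof (rule the_equality)
  show "\<forall>\<gamma>. curve_through (sphere_product k n) x v \<gamma> \<longrightarrow>
    (\<exists>u. has_velocity (\<lambda>t. riem_grad (tuple_indices k n) (sphere_product k n) (tensor_form k n A) (\<gamma> t)) u \<and>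
      synth (coef (gradient_velocity A v)) = orth_proj (tuple_indices k n) T u)"
    using has_velocity_gradient orth_proj_eq by metis
  fix w assume w: "\<forall>\<gamma>. curve_through (sphere_product k n) x v \<gamma> \<longrightarrow>
    (\<exists>u. has_velocity (\<lambda>t. riem_grad (tuple_indices k n) (sphere_product k n) (tensor_form k n A) (\<gamma> t)) u \<and>
      w = orth_proj (tuple_indices k n) T u)"
  obtain \<gamma> where \<gamma>: "curve_through (sphere_product k n) x v \<gamma>"
    using v by (auto simp: tangent_space_def)
  then obtain u where u:
    "has_velocity (\<lambda>t. riem_grad (tuple_indices k n) (sphere_product k n) (tensor_form k n A) (\<gamma> t)) u"
    "w = orth_proj (tuple_indices k n) T u" using w by blast
  have "u = gradient_velocity A v"
    using u(1) has_velocity_gradient[OF \<gamma>, of A] DERIV_unique unfolding has_velocity_def by blast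
  then show "w = synth (coef (gradient_velocity A v))" using u(2) orth_proj_eq by simp
qed

lemma coef_gradient_velocity:
  assumes v: "v \<in> T" and p: "p \<in> Q"
  shows "coef (gradient_velocity A v) p =
    (\<Sum>q\<in>Q. with_diagonal (- contract k n A (curry x)) (hessian_entry A) p q * coef v q)"
proof -
  obtain j a where pja: "p = (j, a)" by (cases p)
  have j: "j \<in> {1..k}" and a: "a \<in> {1..n j}" "a \<noteq> 1" using p by (auto simp: pja tangent_indices_def)
  define X where "X = curry x"
  define d where "d = (\<Sum>l\<in>{1..k}. contract k n A (X(l := curry v l)))"
  define G where "G = contract k n A X"
  have swap: "X(j := f, l := g) = X(l := g, j := f)" if "l \<noteq> j" for f g l
    using that by (simp add: fun_upd_twist)
  have "coef (gradient_velocity A v) p =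
      (\<Sum>i\<in>{1..n j}. \<Sum>l\<in>{1..k} - {j}. U j i a * contract k n A (X(j := unit_vec_fun i, l := curry v l)))
      - d * (\<Sum>i\<in>{1..n j}. x (j, i) * U j i a) - G * (\<Sum>i\<in>{1..n j}. v (j, i) * U j i a)"
  proof -
    have "gradient_velocity A v (j, i) * U j i a =
        (\<Sum>l\<in>{1..k} - {j}. U j i a * contract k n A (X(j := unit_vec_fun i, l := curry v l)))
        - d * (x (j, i) * U j i a) - G * (v (j, i) * U j i a)" if "i \<in> {1..n j}" for i
    proof -
      have "gradient_velocity A v (j, i) =
          (\<Sum>l\<in>{1..k} - {j}. contract k n A (X(j := unit_vec_fun i, l := curry v l)))
          - d * x (j, i) - G * v (j, i)"
        using j that by (simp add: gradient_velocity_def tuple_indices_def X_def d_def G_def)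
      then show ?thesis by (simp add: left_diff_distrib right_diff_distrib sum_distrib_left mult_ac)
    qed
    then show ?thesis by (simp add: pja coef_def sum_subtractf sum_distrib_left)
  qed
  also have "(\<Sum>i\<in>{1..n j}. x (j, i) * U j i a) = (\<Sum>i\<in>{1..n j}. U j i 1 * U j i a)"
    by (intro sum.cong refl) (simp only: first_column[OF j])
  also have "\<dots> = 0" using columns[OF j, of 1 a] a dim_pos[OF j] by simp
  also have "(\<Sum>i\<in>{1..n j}. \<Sum>l\<in>{1..k} - {j}. U j i a * contract k n A (X(j := unit_vec_fun i, l := curry v l))) =
      (\<Sum>l\<in>{1..k} - {j}. \<Sum>i\<in>{1..n j}. U j i a * contract k n A (X(l := curry v l, j := unit_vec_fun i)))"
    by (subst sum.swap) (auto intro!: sum.cong simp: swap)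
  also have "\<dots> = (\<Sum>l\<in>{1..k} - {j}. contract k n A (X(l := curry v l, j := (\<lambda>i. U j i a))))"
    by (intro sum.cong refl contract_slot_coords[OF j, symmetric])
  also have "\<dots> = (\<Sum>l\<in>{1..k} - {j}. \<Sum>b\<in>{2..n l}. hessian_entry A (p, (l, b)) * coef v (l, b))"
  proof (intro sum.cong refl)
    fix l assume l: "l \<in> {1..k} - {j}"
    have "contract k n A (X(l := curry v l, j := (\<lambda>i. U j i a))) =
        contract k n A (X(j := (\<lambda>i. U j i a), l := (\<lambda>i. \<Sum>b\<in>{2..n l}. coef v (l, b) * U l i b)))"
    proof (rule contract_cong)
      fix j' i assume "j' \<in> {1..k}" "i \<in> {1..n j'}"
      then show "(X(l := curry v l, j := (\<lambda>i. U j i a))) j' i =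
        (X(j := (\<lambda>i. U j i a), l := (\<lambda>i. \<Sum>b\<in>{2..n l}. coef v (l, b) * U l i b))) j' i"
        using l synth_at[of j' i "coef v"] synth_coef[OF v] by auto
    qed
    also have "\<dots> = (\<Sum>b\<in>{2..n l}. coef v (l, b) * contract k n A (X(j := (\<lambda>i. U j i a), l := (\<lambda>i. U l i b))))"
      using l by (intro contract_slot_sum) auto
    also have "\<dots> = (\<Sum>b\<in>{2..n l}. hessian_entry A (p, (l, b)) * coef v (l, b))"
      using l by (intro sum.cong refl) (auto simp: hessian_entry_def pja X_def)
    finally show "contract k n A (X(l := curry v l, j := (\<lambda>i. U j i a))) = \<dots>" .
  qed
  also have "\<dots> = (\<Sum>l\<in>{1..k}. \<Sum>b\<in>{2..n l}. hessian_entry A (p, (l, b)) * coef v (l, b))"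
    by (intro sum.mono_neutral_left) (auto simp: hessian_entry_def pja)
  also have "\<dots> = (\<Sum>q\<in>Q. hessian_entry A (p, q) * coef v q)"
    unfolding tangent_indices_def by (subst sum.Sigma) (auto intro!: sum.cong)
  also have "(\<Sum>i\<in>{1..n j}. v (j, i) * U j i a) = coef v p" by (simp add: coef_def pja)
  also have "(\<Sum>q\<in>Q. hessian_entry A (p, q) * coef v q) - d * 0 - G * coef v p =
      (\<Sum>q\<in>Q. (if p = q then - G else hessian_entry A (p, q)) * coef v q)"
  proof -
    have "(if p = q then - G else hessian_entry A (p, q)) * coef v q =
        hessian_entry A (p, q) * coef v q - (if q = p then G * coef v q else 0)" for q
      by (simp add: hessian_entry_def)
    then show ?thesis using finite_Q p by (simp add: sum_subtractf sum.delta)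
  qed
  finally show ?thesis unfolding G_def X_def with_diagonal_def .
qed

lemma nondegenerate_if_hessian_invertible:
  assumes crit: "critical_point (sphere_product k n) (tensor_form k n A) x"
    and inverse: "inverse_matrices Q (with_diagonal (- contract k n A (curry x)) (hessian_entry A)) N"
  shows "nondegenerate_tuple k n A x"
proof -
  define H where "H = with_diagonal (- contract k n A (curry x)) (hessian_entry A)"
  have right: "(\<Sum>r\<in>Q. H p r * N r q) = (if p = q then 1 else 0)"
    and left: "(\<Sum>r\<in>Q. N p r * H r q) = (if p = q then 1 else 0)" if "p \<in> Q" "q \<in> Q" for p q
    using inverse that by (simp_all add: inverse_matrices_def H_def)
  have compose: "synth (\<lambda>p. \<Sum>q\<in>Q. L p q * coef (synth (\<lambda>p. \<Sum>q\<in>Q. M p q * coef w q)) q) = w"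
    if inv: "\<And>p q. p \<in> Q \<Longrightarrow> q \<in> Q \<Longrightarrow> (\<Sum>r\<in>Q. L p r * M r q) = (if p = q then 1 else 0)"
      and w: "w \<in> T" for L M w
  proof -
    have "(\<Sum>q\<in>Q. L p q * coef (synth (\<lambda>p. \<Sum>q\<in>Q. M p q * coef w q)) q) = coef w p"
      if p: "p \<in> Q" for p
    proof -
      have "(\<Sum>q\<in>Q. L p q * coef (synth (\<lambda>p. \<Sum>q\<in>Q. M p q * coef w q)) q) =
          (\<Sum>q\<in>Q. \<Sum>s\<in>Q. (L p q * M q s) * coef w s)"
        by (intro sum.cong refl) (simp add: coef_synth sum_distrib_left mult.assoc)
      also have "\<dots> = (\<Sum>s\<in>Q. (\<Sum>q\<in>Q. L p q * M q s) * coef w s)"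
        by (subst sum.swap) (simp add: sum_distrib_right)
      also have "\<dots> = (\<Sum>s\<in>Q. (if p = s then 1 else 0) * coef w s)"
        using inv p by (intro sum.cong) auto
      also have "\<dots> = coef w p"
        using p finite_Q by (simp add: if_distrib[of "\<lambda>y. y * _"] sum.delta' cong: if_cong)
      finally show ?thesis .
    qed
    then have "synth (\<lambda>p. \<Sum>q\<in>Q. L p q * coef (synth (\<lambda>p. \<Sum>q\<in>Q. M p q * coef w q)) q) = synth (coef w)"
      by (rule synth_cong)
    then show ?thesis using synth_coef[OF w] by simp
  qed
  have hess: "riem_hessian (tuple_indices k n) (sphere_product k n) (tensor_form k n A) x v =
      synth (\<lambda>p. \<Sum>q\<in>Q. H p q * coef v q)" if "v \<in> T" for v
    unfolding riem_hessian_eq[OF that] H_def using that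
    by (intro synth_cong coef_gradient_velocity)
  have "bij_betw (riem_hessian (tuple_indices k n) (sphere_product k n) (tensor_form k n A) x) T T"
  proof (rule bij_betw_byWitness[where f' = "\<lambda>w. synth (\<lambda>p. \<Sum>q\<in>Q. N p q * coef w q)"])
    show "\<forall>v\<in>T. synth (\<lambda>p. \<Sum>q\<in>Q. N p q *
        coef (riem_hessian (tuple_indices k n) (sphere_product k n) (tensor_form k n A) x v) q) = v"
      by (simp add: hess compose[OF left])
    show "\<forall>w\<in>T. riem_hessian (tuple_indices k n) (sphere_product k n) (tensor_form k n A) x
        (synth (\<lambda>p. \<Sum>q\<in>Q. N p q * coef w q)) = w"
      by (simp add: hess synth_in_T compose[OF right])
  qed (auto simp: hess synth_in_T)
  then show ?thesis
    using crit by (simp add: nondegenerate_tuple_def nondegenerate_critical_point_def)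
qed

end

section \<open>Coordinates of a tensor in an adapted frame\<close>

definition base_index :: "nat \<Rightarrow> nat \<Rightarrow> nat" where
  "base_index k = (\<lambda>j\<in>{1..k}. 1)"

context adapted_frame
begin

definition frame_coord :: "((nat \<Rightarrow> nat) \<Rightarrow> real) \<Rightarrow> (nat \<Rightarrow> nat) \<Rightarrow> real" where
  "frame_coord A \<iota> = contract k n A (\<lambda>j i. U j i (\<iota> j))"

lemma frame_expansion:
  assumes \<kappa>: "\<kappa> \<in> tensor_indices k n"
  shows "A \<kappa> = (\<Sum>\<iota>\<in>tensor_indices k n. frame_coord A \<iota> * (\<Prod>j\<in>{1..k}. U j (\<kappa> j) (\<iota> j)))"
proof -
  let ?I = "tensor_indices k n"
  have delta: "(\<Sum>\<iota>\<in>?I. \<Prod>j\<in>{1..k}. U j (\<kappa>' j) (\<iota> j) * U j (\<kappa> j) (\<iota> j)) = (if \<kappa>' = \<kappa> then 1 else 0)"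
    if \<kappa>': "\<kappa>' \<in> ?I" for \<kappa>'
  proof -
    have "(\<Sum>\<iota>\<in>?I. \<Prod>j\<in>{1..k}. U j (\<kappa>' j) (\<iota> j) * U j (\<kappa> j) (\<iota> j)) =
        (\<Prod>j\<in>{1..k}. \<Sum>a\<in>{1..n j}. U j (\<kappa>' j) a * U j (\<kappa> j) a)"
      unfolding tensor_indices_def by (rule prod_sum_PiE[symmetric]) auto
    also have "\<dots> = (\<Prod>j\<in>{1..k}. if \<kappa>' j = \<kappa> j then 1 else 0)"
      by (intro prod.cong refl rows tensor_index_range[OF \<kappa>] tensor_index_range[OF \<kappa>'])
    also have "\<dots> = (if \<kappa>' = \<kappa> then 1 else 0)"
    proof (cases "\<kappa>' = \<kappa>")
      case False
      then have "\<exists>j\<in>{1..k}. \<kappa>' j \<noteq> \<kappa> j"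
        using \<kappa> \<kappa>' PiE_ext unfolding tensor_indices_def by blast
      with False show ?thesis by (auto intro!: prod_zero)
    qed simp
    finally show ?thesis .
  qed
  have "(\<Sum>\<iota>\<in>?I. frame_coord A \<iota> * (\<Prod>j\<in>{1..k}. U j (\<kappa> j) (\<iota> j))) =
      (\<Sum>\<iota>\<in>?I. \<Sum>\<kappa>'\<in>?I. A \<kappa>' * (\<Prod>j\<in>{1..k}. U j (\<kappa>' j) (\<iota> j) * U j (\<kappa> j) (\<iota> j)))"
    by (simp add: frame_coord_def contract_def sum_distrib_right prod.distrib mult.assoc)
  also have "\<dots> = (\<Sum>\<kappa>'\<in>?I. A \<kappa>' * (\<Sum>\<iota>\<in>?I. \<Prod>j\<in>{1..k}. U j (\<kappa>' j) (\<iota> j) * U j (\<kappa> j) (\<iota> j)))"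
    by (subst sum.swap) (simp add: sum_distrib_left)
  also have "\<dots> = (\<Sum>\<kappa>'\<in>?I. A \<kappa>' * (if \<kappa>' = \<kappa> then 1 else 0))"
    by (intro sum.cong refl) (simp only: delta)
  also have "\<dots> = A \<kappa>"
    using \<kappa> finite_tensor_indices by (simp add: if_distrib[of "times _"] sum.delta cong: if_cong)
  finally show ?thesis by simp
qed

lemma frame_coord_base: "frame_coord A (base_index k) = contract k n A (curry x)"
  unfolding frame_coord_def by (rule contract_cong) (use first_column in \<open>simp add: base_index_def\<close>)

lemma frame_coord_two:
  assumes "fst p \<noteq> fst q"
  shows "frame_coord A ((base_index k)(fst p := snd p, fst q := snd q)) = hessian_entry A (p, q)"
  using assms unfolding frame_coord_def hessian_entry_def
  by (simp, intro contract_cong) (use first_column in \<open>auto simp: base_index_def\<close>)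

lemma frame_coord_one:
  assumes crit: "critical_point (sphere_product k n) (tensor_form k n A) x" and q: "q \<in> Q"
  shows "frame_coord A ((base_index k)(fst q := snd q)) = 0"
proof -
  obtain j a where ja: "q = (j, a)" by (cases q)
  have j: "j \<in> {1..k}" and a: "a \<in> {2..n j}" using q by (auto simp: ja tangent_indices_def)
  define v where "v = synth (\<lambda>p. if p = q then 1 else 0)"
  have v: "v (l, i) = (if l = j then U j i a else 0)" if "l \<in> {1..k}" "i \<in> {1..n l}" for l i
    using a unfolding v_def synth_at[OF that]
    by (auto simp: ja if_distrib[of "\<lambda>y. y * _"] sum.delta cong: if_cong)
  have "v \<in> T" by (simp add: v_def synth_in_T)
  then obtain \<gamma> where \<gamma>: "curve_through (sphere_product k n) x v \<gamma>" by (auto simp: tangent_space_def)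
  have "((\<lambda>t. tensor_form k n A (\<gamma> t)) has_real_derivative 0) (at 0)"
    using crit \<gamma> by (auto simp: critical_point_def)
  then have "(\<Sum>l\<in>{1..k}. contract k n A ((curry x)(l := curry v l))) = 0"
    using tensor_form_has_derivative[OF \<gamma>, of A] DERIV_unique by blast
  also have "(\<Sum>l\<in>{1..k}. contract k n A ((curry x)(l := curry v l))) =
      (\<Sum>l\<in>{j}. contract k n A ((curry x)(l := curry v l)))"
    using j v by (intro sum.mono_neutral_right) (auto intro!: contract_slot_zero)
  also have "\<dots> = frame_coord A ((base_index k)(fst q := snd q))"
    unfolding frame_coord_def using v first_column
    by (simp, intro contract_cong) (auto simp: base_index_def ja)
  finally show ?thesis .
qed

end

section \<open>Frames from Householder reflections\<close>

text \<open>This is \<open>\<bar>u\<bar>\<^sup>2\<close> times the Householder reflection in the hyperplane orthogonal to \<open>u\<close>. The factor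
  clears the denominator, so that the entries are polynomials in \<open>u\<close>.\<close>

definition scaled_reflection :: "nat \<Rightarrow> (nat \<Rightarrow> real) \<Rightarrow> nat \<Rightarrow> nat \<Rightarrow> real" where
  "scaled_reflection N u i a = (\<Sum>s\<in>{1..N}. (u s)\<^sup>2) * (if i = a then 1 else 0) - 2 * (u i * u a)"

lemma scaled_reflection_orthogonal:
  assumes "a \<in> {1..N}" "b \<in> {1..N}"
  shows "(\<Sum>i\<in>{1..N}. scaled_reflection N u i a * scaled_reflection N u i b) =
    (\<Sum>s\<in>{1..N}. (u s)\<^sup>2)\<^sup>2 * (if a = b then 1 else 0)"
proof -
  define V where "V = (\<Sum>s\<in>{1..N}. (u s)\<^sup>2)"
  have "(\<Sum>i\<in>{1..N}. scaled_reflection N u i a * scaled_reflection N u i b) =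
      (\<Sum>i\<in>{1..N}. V\<^sup>2 * (if i = a then if a = b then 1 else 0 else 0)
        - 2 * V * u b * (if i = a then u i else 0) - 2 * V * u a * (if i = b then u i else 0)
        + 4 * u a * u b * (u i)\<^sup>2)"
    unfolding scaled_reflection_def V_def[symmetric]
    by (intro sum.cong refl) (auto simp: power2_eq_square algebra_simps)
  also have "\<dots> = V\<^sup>2 * (if a = b then 1 else 0) - 2 * V * u b * u a - 2 * V * u a * u b + 4 * u a * u b * V"
    using assms by (simp add: sum.distrib sum_subtractf V_def sum.delta flip: sum_distrib_left)
  finally show ?thesis unfolding V_def by simp
qed

text \<open>The reflection that exchanges the first basis vector \<open>e\<close> with a unit vector \<open>w \<noteq> e\<close> is given
  by \<open>u = e - w\<close>. Here \<open>w = \<sigma> y\<close>, where the sign is chosen such that \<open>w 1 \<le> 0\<close>; then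
  \<open>u 1 = d\<close> is positive, and division by \<open>d\<close> normalizes it to \<open>1\<close>. The sign and the denominators
  go into the scalar \<open>c\<close>.\<close>

lemma exists_reflection_to_unit_vector:
  assumes N: "N \<ge> 1" and y: "(\<Sum>i\<in>{1..N}. (y i)\<^sup>2) = (1 :: real)"
  shows "\<exists>u c. u 1 = 1 \<and> (\<forall>i\<in>{1..N}. c * scaled_reflection N u i 1 = y i) \<and>
    (\<forall>a\<in>{1..N}. \<forall>b\<in>{1..N}.
      (\<Sum>i\<in>{1..N}. (c * scaled_reflection N u i a) * (c * scaled_reflection N u i b)) =
      (if a = b then 1 else 0))"
proof -
  define \<sigma> :: real where "\<sigma> = (if y 1 > 0 then - 1 else 1)"
  define d where "d = 1 - \<sigma> * y 1"
  have d: "d > 0" by (simp add: d_def \<sigma>_def)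
  have \<sigma>: "\<sigma> * \<sigma> = 1" by (simp add: \<sigma>_def)
  define u where "u = (\<lambda>i. ((if i = 1 then 1 else 0) - \<sigma> * y i) / d)"
  have u1: "u 1 = 1" using d by (simp add: u_def d_def)
  have "(\<Sum>i\<in>{1..N}. (u i)\<^sup>2) =
      (\<Sum>i\<in>{1..N}. (if i = 1 then 1 - 2 * \<sigma> * y i else 0) + (y i)\<^sup>2) / d\<^sup>2"
    unfolding sum_divide_distrib
    by (intro sum.cong refl) (auto simp: u_def power_divide power2_eq_square algebra_simps \<sigma>)
  also have "\<dots> = 2 * d / d\<^sup>2" using N y by (simp add: sum.distrib sum.delta d_def)
  also have "\<dots> = 2 / d" by (simp add: power2_eq_square)
  finally have V: "(\<Sum>i\<in>{1..N}. (u i)\<^sup>2) = 2 / d" .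
  have "\<sigma> * d / 2 * scaled_reflection N u i 1 = y i" for i
  proof -
    have "\<sigma> * d / 2 * scaled_reflection N u i 1 = \<sigma> * ((if i = 1 then 1 else 0) - d * u i)"
      using d unfolding scaled_reflection_def V u1 by (simp add: field_simps)
    also have "d * u i = (if i = 1 then 1 else 0) - \<sigma> * y i" using d by (simp add: u_def)
    finally show ?thesis by (simp add: \<sigma> flip: mult.assoc)
  qed
  moreover have "(\<Sum>i\<in>{1..N}. (\<sigma> * d / 2 * scaled_reflection N u i a) *
      (\<sigma> * d / 2 * scaled_reflection N u i b)) = (if a = b then 1 else 0)"
    if "a \<in> {1..N}" "b \<in> {1..N}" for a b
  proof -
    have "(\<Sum>i\<in>{1..N}. (\<sigma> * d / 2 * scaled_reflection N u i a) *
        (\<sigma> * d / 2 * scaled_reflection N u i b)) =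
        (\<sigma> * d / 2)\<^sup>2 * (\<Sum>i\<in>{1..N}. scaled_reflection N u i a * scaled_reflection N u i b)"
      by (simp add: sum_distrib_left power2_eq_square mult_ac)
    also have "\<dots> = (\<sigma> * d / 2)\<^sup>2 * ((2 / d)\<^sup>2 * (if a = b then 1 else 0))"
      unfolding scaled_reflection_orthogonal[OF that] V ..
    also have "\<dots> = (if a = b then 1 else 0)"
      using d \<sigma> by (simp add: power2_eq_square field_simps)
    finally show ?thesis .
  qed
  ultimately show ?thesis using u1 by (intro exI[of _ u] exI[of _ "\<sigma> * d / 2"]) blast
qed

lemma scaled_reflection_commute: "scaled_reflection N u i a = scaled_reflection N u a i"
  by (simp add: scaled_reflection_def)

section \<open>Parametrization of the tensors with a singular tuple\<close>

text \<open>Relative to an adapted frame, the coordinates of a tensor have the following meaning for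
  the tuple: the one at \<open>base_index\<close> is the value of the form, those at a \<open>single_index\<close> are its first
  derivatives, and those at a \<open>double_index\<close> with different slots are the off-diagonal entries of the
  Hessian.\<close>

definition single_index :: "nat \<Rightarrow> nat \<times> nat \<Rightarrow> nat \<Rightarrow> nat" where
  "single_index k q = (base_index k)(fst q := snd q)"

definition double_index :: "nat \<Rightarrow> (nat \<times> nat) \<times> (nat \<times> nat) \<Rightarrow> nat \<Rightarrow> nat" where
  "double_index k = (\<lambda>(p, q). (base_index k)(fst p := snd p, fst q := snd q))"

lemma index_membership:
  assumes "\<forall>j\<in>{1..k}. n j \<ge> 1"
  shows "base_index k \<in> tensor_indices k n"
    and "q \<in> tangent_indices k n \<Longrightarrow> single_index k q \<in> tensor_indices k n"
    and "p \<in> tangent_indices k n \<Longrightarrow> q \<in> tangent_indices k n \<Longrightarrow> double_index k (p, q) \<in> tensor_indices k n"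
  using assms
  by (auto simp: base_index_def single_index_def double_index_def tensor_indices_def
      tangent_indices_def PiE_iff extensional_def)

lemma index_distinct:
  assumes "q \<in> tangent_indices k n"
  shows "single_index k q \<noteq> base_index k"
    and "p \<in> tangent_indices k n \<Longrightarrow> fst p \<noteq> fst q \<Longrightarrow> double_index k (p, q) \<noteq> base_index k"
    and "p \<in> tangent_indices k n \<Longrightarrow> r \<in> tangent_indices k n \<Longrightarrow> fst p \<noteq> fst q \<Longrightarrow>
      double_index k (p, q) \<noteq> single_index k r"
proof -
  have base: "base_index k (fst q) = 1" "snd q \<noteq> 1" using assms
    by (auto simp: base_index_def tangent_indices_def)
  show "single_index k q \<noteq> base_index k"
    using base by (auto simp: single_index_def dest!: fun_cong[of _ _ "fst q"])
  show "double_index k (p, q) \<noteq> base_index k"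
    using base by (auto simp: double_index_def dest!: fun_cong[of _ _ "fst q"])
  assume p: "p \<in> tangent_indices k n" and ne: "fst p \<noteq> fst q"
  have base_p: "base_index k (fst p) = 1" "snd p \<noteq> 1" using p
    by (auto simp: base_index_def tangent_indices_def)
  show "double_index k (p, q) \<noteq> single_index k r"
  proof
    assume "double_index k (p, q) = single_index k r"
    from fun_cong[OF this, of "fst p"] fun_cong[OF this, of "fst q"] show False
      using base base_p ne by (auto simp: double_index_def single_index_def split: if_splits)
  qed
qed

lemma single_index_inj: "inj_on (single_index k) (tangent_indices k n)"
proof (rule inj_onI)
  fix p q assume pq: "p \<in> tangent_indices k n" "q \<in> tangent_indices k n" "single_index k p = single_index k q"
  have "base_index k (fst p) = 1" "snd p \<noteq> 1"
    using pq by (auto simp: base_index_def tangent_indices_def)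
  with fun_cong[OF pq(3), of "fst p"] show "p = q"
    by (auto simp: single_index_def prod_eq_iff split: if_splits)
qed

text \<open>A point \<open>z\<close> of the tensor space encodes at the same time a tensor for which the standard tuple
  \<open>(e\<^sub>1, \<dots>, e\<^sub>1)\<close> is singular, and a frame. The coordinates at a \<open>single_index\<close> have to vanish
  for such a tensor, so these places of \<open>z\<close> are free to carry the reflection vectors: their number is
  exactly the dimension of the product of spheres. In this way all tensors that have a singular tuple
  are parametrized by a polynomial map of the tensor space into itself.\<close>

definition normal_form_tensor ::
  "nat \<Rightarrow> (nat \<Rightarrow> nat) \<Rightarrow> ((nat \<Rightarrow> nat) \<Rightarrow> real) \<Rightarrow> (nat \<Rightarrow> nat) \<Rightarrow> real" where
  "normal_form_tensor k n z \<iota> = (if \<iota> \<in> single_index k ` tangent_indices k n then 0 else z \<iota>)"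

definition reflection_vector :: "nat \<Rightarrow> ((nat \<Rightarrow> nat) \<Rightarrow> real) \<Rightarrow> nat \<Rightarrow> nat \<Rightarrow> real" where
  "reflection_vector k z j i = (if i = 1 then 1 else z (single_index k (j, i)))"

definition reflected_tensor ::
  "nat \<Rightarrow> (nat \<Rightarrow> nat) \<Rightarrow> (nat \<Rightarrow> nat) \<Rightarrow> ((nat \<Rightarrow> nat) \<Rightarrow> real) \<Rightarrow> real" where
  "reflected_tensor k n \<kappa> z = (\<Sum>\<iota>\<in>tensor_indices k n. normal_form_tensor k n z \<iota> *
     (\<Prod>j\<in>{1..k}. scaled_reflection (n j) (reflection_vector k z j) (\<kappa> j) (\<iota> j)))"

lemma reflected_tensor_polynomial:
  assumes n: "\<forall>j\<in>{1..k}. n j \<ge> 1" and \<kappa>: "\<kappa> \<in> tensor_indices k n"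
  shows "polynomial_fun (tensor_indices k n) (reflected_tensor k n \<kappa>)"
proof -
  let ?I = "tensor_indices k n"
  have u: "polynomial_fun ?I (\<lambda>z. reflection_vector k z j i)" if "j \<in> {1..k}" "i \<in> {1..n j}" for j i
  proof (cases "i = 1")
    case True
    then show ?thesis by (simp add: reflection_vector_def polynomial_fun.const)
  next
    case False
    then have "(j, i) \<in> tangent_indices k n" using that by (auto simp: tangent_indices_def)
    from polynomial_fun.coord[OF index_membership(2)[OF n this]] False
    show ?thesis by (simp add: reflection_vector_def)
  qed
  have R: "polynomial_fun ?I (\<lambda>z. scaled_reflection (n j) (reflection_vector k z j) i a)"
    if "j \<in> {1..k}" "i \<in> {1..n j}" "a \<in> {1..n j}" for j i a
  proof -
    have "polynomial_fun ?I (\<lambda>z. (\<Sum>s\<in>{1..n j}. (reflection_vector k z j s)\<^sup>2) * (if i = a then 1 else 0) +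
        (- 2) * (reflection_vector k z j i * reflection_vector k z j a))"
      by (intro polynomial_fun.add polynomial_fun.mult polynomial_fun_sum polynomial_fun_power
          polynomial_fun.const u that) auto
    then show ?thesis by (simp add: scaled_reflection_def)
  qed
  have B: "polynomial_fun ?I (\<lambda>z. normal_form_tensor k n z \<iota>)" if "\<iota> \<in> ?I" for \<iota>
    unfolding normal_form_tensor_def
    by (cases "\<iota> \<in> single_index k ` tangent_indices k n")
      (simp_all add: that polynomial_fun.const polynomial_fun.coord)
  show ?thesis
    unfolding reflected_tensor_def[abs_def]
    by (intro polynomial_fun_sum finite_tensor_indices polynomial_fun.mult B polynomial_fun_prod R)
      (auto simp: tensor_index_range[OF \<kappa>, simplified] dest: tensor_index_range)
qed

definition block_offdiagonal ::
  "nat \<Rightarrow> ((nat \<Rightarrow> nat) \<Rightarrow> real) \<Rightarrow> (nat \<times> nat) \<times> (nat \<times> nat) \<Rightarrow> real" where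
  "block_offdiagonal k z pq = (if fst (fst pq) = fst (snd pq) then 0 else z (double_index k pq))"

lemma block_offdiagonal_polynomial:
  assumes n: "\<forall>j\<in>{1..k}. n j \<ge> 1" and pq: "p \<in> tangent_indices k n" "q \<in> tangent_indices k n"
  shows "polynomial_fun (tensor_indices k n - {base_index k}) (\<lambda>z. block_offdiagonal k z (p, q))"
proof (cases "fst p = fst q")
  case True
  then show ?thesis by (simp add: block_offdiagonal_def polynomial_fun.const)
next
  case False
  then have "double_index k (p, q) \<in> tensor_indices k n - {base_index k}"
    using index_membership(3)[OF n pq] index_distinct(2)[OF pq(2,1)] by auto
  from polynomial_fun.coord[OF this] False show ?thesis by (simp add: block_offdiagonal_def)
qed

text \<open>Let \<open>U j\<close> be the multiple \<open>c j\<close> of a scaled reflection with first column \<open>x\<^sub>j\<close>, and write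
  the tensor in this frame. Its coordinates at the single indices vanish, since \<open>x\<close> is critical, and
  they are replaced by the entries of the reflection vectors. All other coordinates are multiplied by
  the product \<open>s\<close> of the \<open>c j\<close>. This turns the frame into the unnormalized one that
  \<open>reflected_tensor\<close> uses, and it multiplies the whole Hessian matrix by \<open>s\<close>, so that invertibility
  can be read off from \<open>z\<close>.\<close>

lemma singular_tuple_normal_form:
  assumes n: "\<forall>j\<in>{1..k}. n j \<ge> 1" and sv: "singular_vector_tuple k n A x"
  obtains z where
    "\<And>\<kappa>. \<kappa> \<in> tensor_indices k n \<Longrightarrow> reflected_tensor k n \<kappa> z = A \<kappa>"
    "\<And>N. inverse_matrices (tangent_indices k n)
        (with_diagonal (- z (base_index k)) (block_offdiagonal k z)) N \<Longrightarrow> nondegenerate_tuple k n A x"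
proof -
  have crit: "critical_point (sphere_product k n) (tensor_form k n A) x"
    using sv by (simp add: singular_vector_tuple_def)
  then have x: "x \<in> sphere_product k n" by (simp add: critical_point_def)
  define P where "P = (\<lambda>j u c. u 1 = (1 :: real) \<and>
    (\<forall>i\<in>{1..n j}. c * scaled_reflection (n j) u i 1 = x (j, i)) \<and>
    (\<forall>a\<in>{1..n j}. \<forall>b\<in>{1..n j}.
      (\<Sum>i\<in>{1..n j}. (c * scaled_reflection (n j) u i a) * (c * scaled_reflection (n j) u i b)) =
      (if a = b then 1 else 0)))"
  have "\<exists>u c. P j u c" if j: "j \<in> {1..k}" for j
    unfolding P_def
    by (rule exists_reflection_to_unit_vector) (use x n j in \<open>auto simp: sphere_product_def\<close>)
  then obtain u c where P: "\<And>j. j \<in> {1..k} \<Longrightarrow> P j (u j) (c j)" by metis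
  have u1: "u j 1 = 1" if "j \<in> {1..k}" for j
    using P[OF that] unfolding P_def by blast
  have first: "c j * scaled_reflection (n j) (u j) i 1 = x (j, i)"
    if "j \<in> {1..k}" "i \<in> {1..n j}" for j i
    using P[OF that(1)] that(2) unfolding P_def by blast
  have orth: "(\<Sum>i\<in>{1..n j}. (c j * scaled_reflection (n j) (u j) i a) *
      (c j * scaled_reflection (n j) (u j) i b)) = (if a = b then 1 else 0)"
    if "j \<in> {1..k}" "a \<in> {1..n j}" "b \<in> {1..n j}" for j a b
    using P[OF that(1)] that(2,3) unfolding P_def by blast
  define U where "U = (\<lambda>j i a. c j * scaled_reflection (n j) (u j) i a)"
  interpret adapted_frame k n x U
  proof
    fix j i i' assume "j \<in> {1..k}" "i \<in> {1..n j}" "i' \<in> {1..n j}"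
    from orth[OF this] show "(\<Sum>a\<in>{1..n j}. U j i a * U j i' a) = (if i = i' then 1 else 0)"
      by (simp add: U_def scaled_reflection_commute[of _ _ i] scaled_reflection_commute[of _ _ i'])
  qed (use x n first orth in \<open>auto simp: U_def\<close>)
  define s where "s = (\<Prod>j\<in>{1..k}. c j)"
  define z where "z = (\<lambda>\<iota>. if \<iota> \<in> single_index k ` Q
    then (let q = inv_into Q (single_index k) \<iota> in u (fst q) (snd q)) else s * frame_coord A \<iota>)"
  have z_single: "z (single_index k q) = u (fst q) (snd q)" if "q \<in> Q" for q
    using that single_index_inj by (simp add: z_def Let_def inv_into_f_f)
  have z_base: "z (base_index k) = s * contract k n A (curry x)"
  proof -
    have "base_index k \<notin> single_index k ` Q" using index_distinct(1) by (metis imageE)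
    then show ?thesis by (simp add: z_def frame_coord_base)
  qed
  have z_double: "block_offdiagonal k z (p, q) = s * hessian_entry A (p, q)" if "p \<in> Q" "q \<in> Q" for p q
  proof (cases "fst p = fst q")
    case False
    then have "double_index k (p, q) \<notin> single_index k ` Q"
      using index_distinct(3)[OF that(2,1)] by auto
    with False show ?thesis
      using frame_coord_two[OF False, of A] by (simp add: block_offdiagonal_def z_def double_index_def)
  qed (simp add: block_offdiagonal_def hessian_entry_def)
  have "reflected_tensor k n \<kappa> z = A \<kappa>" if \<kappa>: "\<kappa> \<in> tensor_indices k n" for \<kappa>
  proof -
    have "normal_form_tensor k n z \<iota> *
        (\<Prod>j\<in>{1..k}. scaled_reflection (n j) (reflection_vector k z j) (\<kappa> j) (\<iota> j)) =
        frame_coord A \<iota> * (\<Prod>j\<in>{1..k}. U j (\<kappa> j) (\<iota> j))" if \<iota>: "\<iota> \<in> tensor_indices k n" for \<iota>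
    proof -
      have rv: "reflection_vector k z j i = u j i" if "j \<in> {1..k}" "i \<in> {1..n j}" for j i
        using that u1 z_single[of "(j, i)"] by (auto simp: reflection_vector_def tangent_indices_def)
      have "scaled_reflection (n j) (reflection_vector k z j) (\<kappa> j) (\<iota> j) =
          scaled_reflection (n j) (u j) (\<kappa> j) (\<iota> j)" if j: "j \<in> {1..k}" for j
      proof -
        have "(\<Sum>i\<in>{1..n j}. (reflection_vector k z j i)\<^sup>2) = (\<Sum>i\<in>{1..n j}. (u j i)\<^sup>2)"
          by (intro sum.cong refl) (simp only: rv[OF j])
        then show ?thesis
          unfolding scaled_reflection_def
          using rv[OF j tensor_index_range[OF \<kappa> j]] rv[OF j tensor_index_range[OF \<iota> j]] by simp
      qed
      then have *: "(\<Prod>j\<in>{1..k}. U j (\<kappa> j) (\<iota> j)) =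
          s * (\<Prod>j\<in>{1..k}. scaled_reflection (n j) (reflection_vector k z j) (\<kappa> j) (\<iota> j))"
        by (simp add: U_def s_def prod.distrib)
      have "frame_coord A \<iota> = 0" if "\<iota> \<in> single_index k ` Q"
        using that frame_coord_one[OF crit] by (auto simp: single_index_def)
      then show ?thesis unfolding * by (auto simp: normal_form_tensor_def z_def)
    qed
    then show ?thesis unfolding reflected_tensor_def frame_expansion[OF \<kappa>, of A] by (rule sum.cong[OF refl])
  qed
  moreover have "nondegenerate_tuple k n A x"
    if N: "inverse_matrices Q (with_diagonal (- z (base_index k)) (block_offdiagonal k z)) N" for N
  proof (rule nondegenerate_if_hessian_invertible[OF crit])
    define H where "H = with_diagonal (- contract k n A (curry x)) (hessian_entry A)"
    have H: "with_diagonal (- z (base_index k)) (block_offdiagonal k z) p q = s * H p q"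
      if "p \<in> Q" "q \<in> Q" for p q
      using that by (simp add: H_def with_diagonal_def z_base z_double)
    have "inverse_matrices Q H (\<lambda>p q. s * N p q)"
      unfolding inverse_matrices_def
    proof (intro ballI)
      fix p q assume pq: "p \<in> Q" "q \<in> Q"
      have "(\<Sum>r\<in>Q. H p r * (s * N r q)) =
          (\<Sum>r\<in>Q. with_diagonal (- z (base_index k)) (block_offdiagonal k z) p r * N r q)"
        by (intro sum.cong refl) (simp only: H[OF pq(1)] mult_ac)
      moreover have "(\<Sum>r\<in>Q. s * N p r * H r q) =
          (\<Sum>r\<in>Q. N p r * with_diagonal (- z (base_index k)) (block_offdiagonal k z) r q)"
        by (intro sum.cong refl) (simp only: H[OF _ pq(2)] mult_ac)
      ultimately show "(\<Sum>r\<in>Q. H p r * (s * N r q)) = (if p = q then 1 else 0) \<and>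
          (\<Sum>r\<in>Q. s * N p r * H r q) = (if p = q then 1 else 0)"
        using N pq by (simp add: inverse_matrices_def)
    qed
    then show "inverse_matrices Q (with_diagonal (- contract k n A (curry x)) (hessian_entry A))
        (\<lambda>p q. s * N p q)"
      by (simp add: H_def)
  qed
  ultimately show thesis by (rule that)
qed

section \<open>Generic nondegeneracy\<close>

theorem theorem4p10:
  fixes k :: nat and n :: "nat \<Rightarrow> nat"
  assumes "k \<ge> 3" and "\<forall>j\<in>{1..k}. n j \<ge> 1"
  shows "\<exists>X. zariski_closed (tensor_indices k n) X \<and> X \<subset> tensors k n \<and>
           (\<forall>A \<in> tensors k n - X. \<forall>x. singular_vector_tuple k n A x \<longrightarrow> nondegenerate_tuple k n A x)"
proof -
  let ?I = "tensor_indices k n" and ?Q = "tangent_indices k n" and ?b = "base_index k"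
  note n = assms(2)
  have finQ: "finite ?Q" by (auto simp: tangent_indices_def)
  obtain c where
    c_poly: "\<forall>l<card ?Q. polynomial_fun {(p, q). p \<in> ?Q \<and> q \<in> ?Q \<and> p \<noteq> q} (c l)" and
    c_inv: "\<forall>M \<mu>. \<mu> ^ card ?Q \<noteq> (\<Sum>l<card ?Q. c l M * \<mu> ^ l) \<longrightarrow>
      (\<exists>N. inverse_matrices ?Q (with_diagonal (- \<mu>) M) N)"
    using characteristic_relation[OF finQ] by blast
  have "polynomial_fun (?I - {?b}) (\<lambda>z. c l (block_offdiagonal k z))" if "l < card ?Q" for l
  proof (rule polynomial_fun_subst[where f = "\<lambda>pq z. block_offdiagonal k z pq"])
    show "polynomial_fun {(p, q). p \<in> ?Q \<and> q \<in> ?Q \<and> p \<noteq> q} (c l)" using c_poly that by blast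
    fix pq assume "pq \<in> {(p, q). p \<in> ?Q \<and> q \<in> ?Q \<and> p \<noteq> q}"
    then show "polynomial_fun (?I - {?b}) (\<lambda>z. block_offdiagonal k z pq)"
      using block_offdiagonal_polynomial[OF n] by auto
  qed
  \<comment> \<open>The hypersurface consists of the \<open>z\<close> for which the value \<open>z ?b\<close> of the form is an eigenvalue of
    the off-diagonal part of the Hessian.\<close>
  from image_of_monic_hypersurface_not_dense[where F = "reflected_tensor k n"
        and m = "card ?Q" and c = "\<lambda>l z. c l (block_offdiagonal k z)",
      OF finite_tensor_indices index_membership(1)[OF n] reflected_tensor_polynomial[OF n] this]
  obtain p a where p: "polynomial_fun ?I p" "p a \<noteq> 0"
    and vanish: "\<And>z. z ?b ^ card ?Q = (\<Sum>l<card ?Q. c l (block_offdiagonal k z) * z ?b ^ l) \<Longrightarrow>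
      p (\<lambda>\<kappa>. reflected_tensor k n \<kappa> z) = 0"
    by blast
  define X where "X = {A \<in> coord_space ?I. \<forall>q\<in>{p}. q A = 0}"
  have "zariski_closed ?I X"
    unfolding zariski_closed_def X_def using p(1) by (intro exI[of _ "{p}"]) auto
  moreover have "X \<subset> tensors k n"
  proof
    show "X \<subseteq> tensors k n" by (auto simp: X_def tensors_def)
    define a' where "a' = (\<lambda>i. if i \<in> ?I then a i else 0)"
    have "p a' = p a" by (rule polynomial_fun_local[OF p(1)]) (simp add: a'_def)
    then have "a' \<notin> X" using p(2) by (simp add: X_def)
    moreover have "a' \<in> tensors k n" by (simp add: a'_def tensors_def coord_space_def)
    ultimately show "X \<noteq> tensors k n" by auto
  qed
  moreover have "nondegenerate_tuple k n A x"
    if A: "A \<in> tensors k n - X" and sv: "singular_vector_tuple k n A x" for A x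
  proof -
    obtain z where z: "\<And>\<kappa>. \<kappa> \<in> ?I \<Longrightarrow> reflected_tensor k n \<kappa> z = A \<kappa>"
      and nondeg: "\<And>N. inverse_matrices ?Q (with_diagonal (- z ?b) (block_offdiagonal k z)) N
        \<Longrightarrow> nondegenerate_tuple k n A x"
      using singular_tuple_normal_form[OF n sv] by blast
    have "p (\<lambda>\<kappa>. reflected_tensor k n \<kappa> z) = p A"
      by (rule polynomial_fun_local[OF p(1)]) (rule z)
    moreover have "p A \<noteq> 0" using A by (auto simp: X_def tensors_def)
    ultimately have "z ?b ^ card ?Q \<noteq> (\<Sum>l<card ?Q. c l (block_offdiagonal k z) * z ?b ^ l)"
      using vanish by auto
    from c_inv[THEN spec, THEN spec, THEN mp, OF this] show ?thesis
      by (elim exE) (erule nondeg)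
  qed
  ultimately show ?thesis by blast
qed

end
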